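(* Let $X$ be an oriented graph with at least two vertices. If $X$ admits universal perfect state transfer, then the underlying (undirected) graph of $X$ is $K_2$ or $K_3$.
   Context: An oriented graph $X$ on vertex set $V$ is a simple graph each of whose edges is given a direction (an arc). Its associated Hermitian matrix $H$ (rows and columns indexed by $V$) has $H_{a,b}=i$ if there is an arc from $a$ to $b$, $H_{a,b}=-i$ if there is an arc from $b$ to $a$, and $H_{a,b}=0$ otherwise. The transition matrix is $U(t)=e^{-itH}$, $t\in\mathbb{R}$. There is perfect state transfer from vertex $a$ to vertex $b$ at time $\tau$ if $U(\tau)e_a=\alpha e_b$ for some complex number $\alpha$ with $|\alpha|=1$, where $e_v$ denotes the standard basis vector of vertex $v$. $X$ admits universal perfect state transfer if for every pair of distinct vertices $a,b$ there is perfect state transfer from $a$ to $b$ at some time. *)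

theory Defs
  imports "HOL-Analysis.Analysis" "Graph_Theory.Graph_Theory"
begin

text \<open>A simple graph with each edge directed one way: no loops, and at most one arc between two
  vertices.\<close>

locale oriented_graph = pair_digraph X for X :: "'v pair_pre_digraph" +
  assumes asym_arcs: "asym (parcs X)"

text \<open>Rows and columns are indexed by the whole (finite) type of vertices, so this is the matrix of
  \<open>X\<close> when \<open>pverts X = UNIV\<close>. Every finite nonempty vertex set can be taken to be such a type.\<close>

definition hermitian_matrix :: "'v::finite pair_pre_digraph \<Rightarrow> complex ^ 'v ^ 'v" where
  "hermitian_matrix X = (\<chi> a b. if (a, b) \<in> parcs X then \<i>
                                else if (b, a) \<in> parcs X then - \<i> else 0)"

text \<open>The library multiplies vectors, hence also matrices, componentwise; its powers and
  exponentials are therefore not those of the matrix product \<open>**\<close>.\<close>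

primrec matrix_power :: "complex ^ 'n ^ 'n \<Rightarrow> nat \<Rightarrow> complex ^ 'n ^ 'n" where
  "matrix_power A 0 = mat 1"
| "matrix_power A (Suc k) = A ** matrix_power A k"

definition matrix_exp :: "complex ^ 'n ^ 'n \<Rightarrow> complex ^ 'n ^ 'n" where
  "matrix_exp A = (\<Sum>k. matrix_power A k /\<^sub>R fact k)"

text \<open>The exponential series always converges, so \<^const>\<open>suminf\<close> never takes a junk value.\<close>

lemma norm_matrix_power_entry_le:
  fixes A :: "complex ^ 'n ^ 'n"
  shows "norm (matrix_power A k $ i $ j) \<le> (\<Sum>a\<in>UNIV. \<Sum>b\<in>UNIV. norm (A $ a $ b)) ^ k"
proof (induction k arbitrary: i j)
  case 0
  then show ?case by (simp add: mat_def)
next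
  case (Suc k)
  let ?c = "\<Sum>a\<in>UNIV. \<Sum>b\<in>UNIV. norm (A $ a $ b)"
  have "norm (matrix_power A (Suc k) $ i $ j)
      \<le> (\<Sum>l\<in>UNIV. norm (A $ i $ l * matrix_power A k $ l $ j))"
    by (simp add: matrix_matrix_mult_def norm_sum)
  also have "\<dots> \<le> (\<Sum>l\<in>UNIV. norm (A $ i $ l) * ?c ^ k)"
    by (intro sum_mono) (simp add: norm_mult mult_left_mono Suc.IH)
  also have "\<dots> = (\<Sum>l\<in>UNIV. norm (A $ i $ l)) * ?c ^ k"
    by (simp add: sum_distrib_right)
  also have "\<dots> \<le> ?c * ?c ^ k"
  proof (rule mult_right_mono)
    show "(\<Sum>l\<in>UNIV. norm (A $ i $ l)) \<le> ?c"
      by (rule member_le_sum) (auto intro: sum_nonneg)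
    show "0 \<le> ?c ^ k" by (intro zero_le_power sum_nonneg) simp
  qed
  finally show ?case by simp
qed

lemma matrix_exp_sums:
  "(\<lambda>k. matrix_power A k /\<^sub>R fact k) sums matrix_exp A"
proof -
  let ?c = "\<Sum>a\<in>UNIV. \<Sum>b\<in>UNIV. norm (A $ a $ b)"
  let ?f = "\<lambda>k. matrix_power A k /\<^sub>R fact k"
  have "summable (\<lambda>k. ?f k $ i $ j)" for i j
  proof (rule summable_comparison_test')
    show "summable (\<lambda>k. ?c ^ k /\<^sub>R fact k)" by (rule summable_exp_generic)
    show "norm (?f k $ i $ j) \<le> ?c ^ k /\<^sub>R fact k" for k
      using norm_matrix_power_entry_le[of A k i j] by (simp add: mult_left_mono)
  qed
  then have "(\<lambda>k. ?f k $ i $ j) sums (\<Sum>k. ?f k $ i $ j)" for i j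
    by (rule summable_sums)
  then have "?f sums (\<chi> i j. \<Sum>k. ?f k $ i $ j)"
    unfolding sums_def by (intro vec_tendstoI) (simp add: sum_component)
  then show ?thesis
    unfolding matrix_exp_def by (simp add: sums_iff)
qed

definition transition_matrix :: "'v::finite pair_pre_digraph \<Rightarrow> real \<Rightarrow> complex ^ 'v ^ 'v" where
  "transition_matrix X t =
     matrix_exp (\<chi> a b. - \<i> * complex_of_real t * hermitian_matrix X $ a $ b)"

definition perfect_state_transfer ::
    "'v::finite pair_pre_digraph \<Rightarrow> 'v \<Rightarrow> 'v \<Rightarrow> real \<Rightarrow> bool" where
  "perfect_state_transfer X a b \<tau> \<longleftrightarrow>
     (\<exists>\<alpha>::complex. norm \<alpha> = 1 \<and> transition_matrix X \<tau> *v axis a 1 = \<alpha> *s axis b 1)"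

definition universal_perfect_state_transfer :: "'v::finite pair_pre_digraph \<Rightarrow> bool" where
  "universal_perfect_state_transfer X \<longleftrightarrow>
     (\<forall>a\<in>pverts X. \<forall>b\<in>pverts X. a \<noteq> b \<longrightarrow> (\<exists>\<tau>. perfect_state_transfer X a b \<tau>))"

end

theory Submission
  imports Defs "HOL-Computational_Algebra.Squarefree" "Jordan_Normal_Form.Char_Poly"
begin

text \<open>Write \<open>H = \<i>S\<close> with \<open>S\<close> real skew-symmetric, so that \<open>U(t) = exp (tS)\<close> is real orthogonal and all
  phases are \<open>\<plusminus>1\<close>. Transfer between all vertices forces every coordinate vector to be cyclic for
  \<open>S\<close>; hence \<open>H\<close> has \<open>n\<close> distinct eigenvalues, closed under negation, and all diagonal entries of
  each \<open>S\<^sup>k\<close> agree, so the power sums of the eigenvalues are divisible by \<open>n\<close>. Moreover a transfer time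
  \<open>\<tau> \<noteq> 0\<close> makes \<open>exp (\<tau>S)\<close> a rational matrix. By the method of Gelfond and Schneider, any two
  eigenvalues are then linearly dependent over the rationals: the auxiliary function is an integer
  combination of the vectors \<open>exp (k\<tau>zS)e \<otimes> exp (l\<tau>zS)e\<close>, and since all conjugates are treated
  simultaneously as entries of one vector, integrality replaces the usual norm estimate. So the
  eigenvalues are \<open>m * sqrt d\<close> for distinct integers \<open>m\<close>, whose squares are too large for
  \<open>tr H\<^sup>2 \<le> n (n - 1)\<close> unless \<open>n\<close> is small, and divisibility of the power sums excludes the remaining
  cases other than \<open>n \<in> {2, 3}\<close>.\<close>

text \<open>Why transcendence theory enters: rationality of \<open>exp (\<tau>S)\<close> makes every
  number \<open>exp (\<i> * \<tau> * \<theta>)\<close>, with \<open>\<theta>\<close> an eigenvalue,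
  algebraic, and ratios of eigenvalues are algebraic as well. An irrational ratio of two of them
  would then be an irrational algebraic exponent taking an algebraic number to an algebraic number.
  Because the flow is orthogonal, the s-th derivative of the auxiliary function is bounded on the
  whole real line by a constant times an s-th power. Rolle's theorem at real nodes can therefore
  take the place of the complex maximum principle. The tensor product supplies two commuting
  integral operators, \<open>S\<close> on the first and \<open>S\<close> on the second factor. A
  common left eigenvector for the two given eigenvalues is needed only to see that the auxiliary
  function is not zero; all size estimates are made on real vectors. In the final count, p distinct
  positive integers have a sum of squares of cubic order in p, against the quadratic bound on the
  trace.\<close>

no_notation vec_index (infixl "$" 100)
no_notation scalar_prod (infix "\<bullet>" 70)
hide_const (open) Matrix.orthogonal Matrix.row
hide_fact (open) Matrix.orthogonal_def Matrix.vec_eq_iff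

section \<open>Rolle interpolation bound\<close>

text \<open>Rolle's theorem with multiplicities: \<open>h s\<close> plays the s-th derivative, and a
  zero of multiplicity k appears as k equal entries of the sorted list \<open>x\<close>. Passing to
  the derivative leaves one point fewer: a Rolle zero inside each proper gap, and the repeated point
  itself inside each run of equal entries, whose multiplicity drops by one.\<close>

lemma rolle_multiplicities:
  fixes h :: "nat \<Rightarrow> real \<Rightarrow> real" and x :: "nat \<Rightarrow> real"
  assumes "\<And>s z. (h s has_real_derivative h (Suc s) z) (at z)"
    and "\<And>i j. i \<le> j \<Longrightarrow> j \<le> M \<Longrightarrow> x i \<le> x j"
    and "\<And>i j. i \<le> j \<Longrightarrow> j \<le> M \<Longrightarrow> x i = x j \<Longrightarrow> h (j - i) (x i) = 0"
  shows "\<exists>z. h M z = 0"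
  using assms
proof (induction M arbitrary: h x)
  case 0
  then show ?case by (metis diff_self_eq_0 le_refl)
next
  case (Suc M)
  note der = Suc.prems(1) and mono = Suc.prems(2) and zero = Suc.prems(3)
  have "\<exists>y. x i \<le> y \<and> y \<le> x (Suc i) \<and> (x i < x (Suc i) \<longrightarrow> x i < y \<and> y < x (Suc i) \<and> h 1 y = 0)"
    if "i \<le> M" for i
  proof (cases "x i < x (Suc i)")
    case True
    have "h 0 (x i) = 0" "h 0 (x (Suc i)) = 0"
      using zero[of i i] zero[of "Suc i" "Suc i"] that by auto
    moreover have "continuous_on {x i..x (Suc i)} (h 0)"
      using der DERIV_isCont by (blast intro: continuous_at_imp_continuous_on)
    ultimately obtain z where "x i < z" "z < x (Suc i)" "DERIV (h 0) z :> 0"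
      using Rolle[OF True, of "h 0"] der by (auto simp: real_differentiable_def)
    then have "x i < z \<and> z < x (Suc i) \<and> h (Suc 0) z = 0"
      using DERIV_unique[OF der[of 0 z]] by blast
    then show ?thesis by (intro exI[of _ z]) simp
  next
    case False
    then show ?thesis using mono[of i "Suc i"] that by auto
  qed
  then obtain y where y: "\<And>i. i \<le> M \<Longrightarrow> x i \<le> y i \<and> y i \<le> x (Suc i)"
    and y': "\<And>i. i \<le> M \<Longrightarrow> x i < x (Suc i) \<Longrightarrow> x i < y i \<and> y i < x (Suc i) \<and> h 1 (y i) = 0"
    by metis
  have "\<exists>z. h (Suc M) z = 0"
  proof (rule Suc.IH[of "\<lambda>s. h (Suc s)" y])
    show "y i \<le> y j" if "i \<le> j" "j \<le> M" for i j
    proof (cases "i = j")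
      case False
      then have "x (Suc i) \<le> x j" using that by (intro mono) auto
      then show ?thesis using y[of i] y[of j] that by auto
    qed auto
    show "h (Suc (j - i)) (y i) = 0" if ij: "i \<le> j" "j \<le> M" "y i = y j" for i j
    proof (cases "i = j \<and> x i < x (Suc i)")
      case True
      then show ?thesis using y'[of i] ij by auto
    next
      case False
      \<comment> \<open>Rolle points of proper gaps are strictly interior, so this case can only
        come from a single run of equal \<open>x\<close>. That run is one entry longer than the run
        of \<open>y\<close>, which matches the shift from \<open>h s\<close> to
        \<open>h (Suc s)\<close>.\<close>
      have e: "x i = x (Suc j) \<and> y i = x i"
      proof (cases "i = j")
        case True
        then show ?thesis using False y[of i] ij by auto
      next
        case ne: False
        then have "x (Suc i) \<le> x j" using ij by (intro mono) auto
        then have *: "y i = x (Suc i)" "y j = x j" "x (Suc i) = x j"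
          using y[of i] y[of j] ij by auto
        then have "\<not> x i < x (Suc i)" "\<not> x j < x (Suc j)" using y'[of i] y'[of j] ij by auto
        then show ?thesis using * mono[of i "Suc i"] mono[of j "Suc j"] ij by auto
      qed
      then show ?thesis using zero[of i "Suc j"] ij by (simp add: Suc_diff_le)
    qed
  qed (rule der)
  then show ?case .
qed

text \<open>One derivative turns \<open>(z - a) ^ Suc r * G\<close> into \<open>(z - a) ^ r\<close>
  times a polynomial whose value at \<open>a\<close> is \<open>Suc r * poly G a\<close>, so the
  factors accumulate to the factorial.\<close>

lemma higher_pderiv_linear_power_mult:
  fixes a :: "'a :: {idom,semiring_char_0}" and G :: "'a poly"
  shows "poly ((pderiv ^^ r) ([:- a, 1:] ^ r * G)) a = fact r * poly G a"
proof (induction r arbitrary: G)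
  case (Suc r)
  define p where "p = [:- a, 1:]"
  have "pderiv p = 1" by (simp add: p_def pderiv_pCons)
  then have "pderiv (p ^ Suc r * G) = p ^ r * (Polynomial.smult (of_nat (Suc r)) G + p * pderiv G)"
    unfolding pderiv_mult pderiv_power_Suc by (simp add: algebra_simps del: of_nat_Suc)
  then have "pderiv ([:- a, 1:] ^ Suc r * G)
      = [:- a, 1:] ^ r * (Polynomial.smult (of_nat (Suc r)) G + [:- a, 1:] * pderiv G)"
    unfolding p_def .
  then show ?case
    by (simp only: funpow_Suc_right o_def Suc.IH) (simp add: algebra_simps)
qed simp

lemma higher_pderiv_linear_power_mult_eq_0:
  fixes a :: "'a :: {idom,semiring_char_0}" and G :: "'a poly"
  assumes "s < r"
  shows "poly ((pderiv ^^ s) ([:- a, 1:] ^ r * G)) a = 0"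
proof -
  have *: "[:- a, 1:] ^ r * G = [:- a, 1:] ^ s * ([:- a, 1:] ^ (r - s) * G)"
    using assms by (metis le_add_diff_inverse less_imp_le mult.assoc power_add)
  show ?thesis
    unfolding * higher_pderiv_linear_power_mult using assms by simp
qed

lemma higher_pderiv_degree_monic:
  fixes P :: "real poly"
  assumes "degree P = n" "lead_coeff P = 1"
  shows "(pderiv ^^ n) P = [:fact n:]"
proof -
  have "degree ((pderiv ^^ n) P) = 0" using assms by (simp add: degree_higher_pderiv)
  moreover have "coeff ((pderiv ^^ n) P) 0 = fact n"
    using assms by (simp add: coeff_higher_pderiv pochhammer_fact)
  ultimately show ?thesis by (metis degree_eq_zeroE coeff_pCons_0)
qed

text \<open>Subtracting the multiple of \<open>\<Prod>j<q. (z - j) ^ r\<close> that cancels the \<open>r\<close>-th derivative at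
  \<open>m\<close> leaves \<open>q * r + 1\<close> zeros, so Rolle's theorem evaluates the \<open>q * r\<close>-th derivative.\<close>

lemma interpolation_derivative_bound:
  fixes f :: "nat \<Rightarrow> real \<Rightarrow> real"
  assumes der: "\<And>s z. (f s has_real_derivative f (Suc s) z) (at z)"
    and zero: "\<And>s j. s < r \<Longrightarrow> j < q \<Longrightarrow> f s (real j) = 0"
    and bound: "\<And>z. \<bar>f (q * r) z\<bar> \<le> B"
    and m: "m < q"
  shows "\<bar>f r (real m)\<bar> * fact (q * r) \<le> fact r * real q ^ (q * r) * B"
proof (cases "r = 0")
  case True
  then show ?thesis using bound[of m] by simp
next
  case r: False
  define P where "P = (\<Prod>j<q. [:- real j, 1:] ^ r)"
  define G where "G j = (\<Prod>i\<in>{..<q}-{j}. [:- real i, 1:] ^ r)" for j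
  have PG: "P = [:- real j, 1:] ^ r * G j" if "j < q" for j
    unfolding P_def G_def using that by (subst prod.remove[of _ j]) auto
  have degP: "degree P = q * r"
    unfolding P_def by (subst degree_prod_eq_sum_degree) (auto simp: degree_power_eq)
  have leadP: "lead_coeff P = 1"
    unfolding P_def by (simp add: lead_coeff_prod lead_coeff_power)
  define g where "g = poly (G m) (real m)"
  have g: "g = (\<Prod>i\<in>{..<q}-{m}. (real m - real i) ^ r)"
    unfolding g_def G_def by (simp add: poly_prod)
  have g0: "g \<noteq> 0" unfolding g by auto
  \<comment> \<open>Nodes below \<open>q\<close> differ by less than \<open>q\<close>, and
    \<open>q - 1\<close> of them are distinct from \<open>m\<close>; the exponent is then rounded up
    to \<open>q * r\<close>.\<close>
  have "\<bar>g\<bar> = (\<Prod>i\<in>{..<q}-{m}. \<bar>real m - real i\<bar> ^ r)"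
    unfolding g by (simp add: abs_prod power_abs)
  also have "\<dots> \<le> (\<Prod>i\<in>{..<q}-{m}. real q ^ r)"
    using m by (intro prod_mono conjI power_mono) auto
  also have "\<dots> = real q ^ ((q - 1) * r)"
    using m by (simp add: power_mult[symmetric] mult.commute)
  also have "\<dots> \<le> real q ^ (q * r)"
    using m by (intro power_increasing) auto
  finally have gq: "\<bar>g\<bar> \<le> real q ^ (q * r)" .
  define c where "c = f r (real m) / (fact r * g)"
  define h where "h s z = f s z - c * poly ((pderiv ^^ s) P) z" for s z
  have h0: "h s (real j) = 0" if "s < r" "j < q" for s j
    unfolding h_def using zero[OF that] PG[OF that(2)]
    by (simp add: higher_pderiv_linear_power_mult_eq_0 that(1))
  have hm: "h r (real m) = 0"
    unfolding h_def PG[OF m] higher_pderiv_linear_power_mult g_def[symmetric] c_def using g0 by simp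
  \<comment> \<open>The sorted list for Rolle: every node below \<open>q\<close> occurs
    \<open>r\<close> times, except \<open>m\<close>, which occurs \<open>r + 1\<close> times. Index
    \<open>Suc m * r\<close> is the extra copy, and from there on the numbering lags by one.\<close>
  define y where "y i = (if i < Suc m * r then i div r else (i - 1) div r)" for i
  have d: "n div r * r \<le> n" "n < Suc (n div r) * r" for n
    using r div_times_less_eq_dividend[of n r] dividend_less_div_times[of r n] by auto
  have low: "i div r \<le> m" if "i < Suc m * r" for i
    using that r less_mult_imp_div_less[of i "Suc m" r] by simp
  have high: "m \<le> (i - 1) div r" if "\<not> i < Suc m * r" for i
  proof -
    have "m * r \<le> i - 1" using that r by simp
    then show ?thesis using r by (simp add: less_eq_div_iff_mult_less_eq)
  qed
  have y_le: "y i < q" if "i \<le> q * r" for i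
  proof (cases "i < Suc m * r")
    case True
    then show ?thesis using low[OF True] m by (simp add: y_def)
  next
    case False
    then have "i - 1 < q * r" using that r by auto
    then show ?thesis using False by (simp add: y_def less_mult_imp_div_less)
  qed
  have y_mono: "y i \<le> y j" if "i \<le> j" for i j
  proof (cases "i < Suc m * r")
    case True
    then show ?thesis using low[OF True] high[of j] that by (auto simp: y_def intro: div_le_mono)
  next
    case False
    then have "\<not> j < Suc m * r" using that by linarith
    then show ?thesis using False that by (simp add: y_def div_le_mono)
  qed
  have lo1: "y i * r \<le> i" if "i < Suc m * r" for i
    using that d(1)[of i] unfolding y_def by (simp only: if_True)
  have hi1: "i < Suc (y i) * r" if "i < Suc m * r" for i
    using that d(2)[of i] unfolding y_def by (simp only: if_True)
  have lo2: "y i * r \<le> i - 1" if "\<not> i < Suc m * r" for i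
    using that d(1)[of "i - 1"] unfolding y_def by (simp only: if_False)
  have hi2: "i - 1 < Suc (y i) * r" if "\<not> i < Suc m * r" for i
    using that d(2)[of "i - 1"] unfolding y_def by (simp only: if_False)
  have run: "(if y i = m then j - i \<le> r else j - i < r)" if ij: "i \<le> j" "y i = y j" for i j
  proof (cases "j < Suc m * r")
    case True
    then have "i < Suc m * r" using ij by linarith
    then have "y j * r \<le> i" "j < y j * r + r"
      using lo1[of i] hi1[OF True] ij(2) by simp_all
    then have "j - i < r" using r by linarith
    then show ?thesis by simp
  next
    case j: False
    have *: "j - 1 < y j * r + r" using hi2[OF j] by simp
    show ?thesis
    proof (cases "i < Suc m * r")
      case True
      have "y j * r \<le> i" using lo1[OF True] ij by simp
      then have "j - i \<le> r" using * r by linarith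
      moreover have "y i = m"
        using low[OF True] high[OF j] True j ij(2) unfolding y_def by (simp only: if_True if_False)
      ultimately show ?thesis by simp
    next
      case i: False
      have "y j * r \<le> i - 1" using lo2[OF i] ij by simp
      moreover have "i \<ge> 1" using i r by (cases i) auto
      ultimately have "j - i < r" using * r by linarith
      then show ?thesis by simp
    qed
  qed
  obtain \<xi> where \<xi>: "h (q * r) \<xi> = 0"
  proof (rule exE[OF rolle_multiplicities[of h "q * r" "\<lambda>i. real (y i)"]])
    show "(h s has_real_derivative h (Suc s) z) (at z)" for s z
      unfolding h_def by (auto intro!: derivative_eq_intros der)
    show "h (j - i) (real (y i)) = 0"
      if ij: "i \<le> j" "j \<le> q * r" "real (y i) = real (y j)" for i j
    proof -
      have "y i < q" using y_le[of i] ij by simp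
      moreover have "if y i = m then j - i \<le> r else j - i < r" using run ij by simp
      ultimately show ?thesis using h0[of "j - i" "y i"] hm
        by (cases "j - i = r") (auto split: if_splits)
    qed
  qed (use y_mono in auto)
  \<comment> \<open>\<open>P\<close> is monic of degree \<open>q * r\<close>, so its derivative of
    that order is constant, and the bound on \<open>f (q * r)\<close> becomes a bound on
    \<open>c\<close>.\<close>
  have "f (q * r) \<xi> = c * fact (q * r)"
    using \<xi> unfolding h_def by (simp add: higher_pderiv_degree_monic[OF degP leadP])
  then have "\<bar>c\<bar> * fact (q * r) \<le> B"
    using bound[of \<xi>] by (simp add: abs_mult)
  then have "fact r * \<bar>g\<bar> * (\<bar>c\<bar> * fact (q * r)) \<le> fact r * real q ^ (q * r) * B"
    using gq by (intro mult_mono) auto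
  moreover have "\<bar>f r (real m)\<bar> = fact r * \<bar>g\<bar> * \<bar>c\<bar>"
    unfolding c_def using g0 by (simp add: abs_mult)
  ultimately show ?thesis by (simp add: mult.assoc)
qed

section \<open>A vector form of the Gelfond--Schneider theorem\<close>

lemma linear_funpow:
  fixes f :: "'a :: real_vector \<Rightarrow> 'a"
  shows "linear f \<Longrightarrow> linear (f ^^ k)"
  by (induction k) (auto simp: linear_ident id_def o_def intro: linear_compose[unfolded o_def])

text \<open>Siegel's lemma by pigeonhole. For unknowns in \<open>{0..X}\<close> each form has at
  most \<open>X * X + 1\<close> values, while two unknowns per equation allow
  \<open>(X + 1) ^ 2\<close> choices; two choices with equal values differ by a nontrivial solution.
  Having twice as many unknowns as equations is what keeps the solution linear in
  \<open>W\<close>.\<close>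

lemma siegel_small_solution:
  fixes a :: "'e \<Rightarrow> 'p \<Rightarrow> int" and W :: int
  assumes fin: "finite E" "finite P" and card: "card P = 2 * card E" "E \<noteq> {}"
    and W: "W \<ge> 1" "\<And>e p. e \<in> E \<Longrightarrow> p \<in> P \<Longrightarrow> \<bar>a e p\<bar> \<le> W"
  obtains c :: "'p \<Rightarrow> int" where "\<exists>p\<in>P. c p \<noteq> 0" "\<And>p. p \<in> P \<Longrightarrow> \<bar>c p\<bar> \<le> int (card P) * W"
    "\<And>e. e \<in> E \<Longrightarrow> (\<Sum>p\<in>P. a e p * c p) = 0"
proof -
  define X where "X = int (card P) * W"
  \<comment> \<open>The least value of the form \<open>e\<close> on the box: \<open>X\<close> where
    the coefficient is negative, 0 elsewhere. The absolute values of the coefficients add up to at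
    most \<open>X\<close>, so the spread is at most \<open>X * X\<close>.\<close>
  define lo where "lo e = (\<Sum>p\<in>P. min (a e p) 0 * X)" for e
  define S where "S = (PiE P (\<lambda>_. {0..X}))"
  define R where "R = (PiE E (\<lambda>e. {lo e..lo e + X * X}))"
  define \<Phi> where "\<Phi> c = restrict (\<lambda>e. \<Sum>p\<in>P. a e p * c p) E" for c :: "'p \<Rightarrow> int"
  have cE: "card E \<ge> 1" using fin card(2) by (simp add: Suc_leI card_gt_0_iff)
  then have X1: "X \<ge> 1" using card W(1) unfolding X_def
    using mult_mono[of 1 "int (card P)" 1 W] by simp
  have "\<Phi> c \<in> R" if "c \<in> S" for c
  proof -
    have c: "0 \<le> c p" "c p \<le> X" if "p \<in> P" for p
      using \<open>c \<in> S\<close> that by (auto simp: S_def PiE_iff)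
    have "lo e \<le> (\<Sum>p\<in>P. a e p * c p)" for e
      unfolding lo_def
    proof (rule sum_mono)
      fix p assume p: "p \<in> P"
      show "min (a e p) 0 * X \<le> a e p * c p"
        using c[OF p] X1
        by (cases "a e p \<ge> 0") (auto simp: min_def intro: mult_left_mono_neg)
    qed
    moreover have "(\<Sum>p\<in>P. a e p * c p) \<le> lo e + X * X" if e: "e \<in> E" for e
    proof -
      have "(\<Sum>p\<in>P. a e p * c p) \<le> (\<Sum>p\<in>P. min (a e p) 0 * X + W * X)"
      proof (rule sum_mono)
        fix p assume p: "p \<in> P"
        show "a e p * c p \<le> min (a e p) 0 * X + W * X"
        proof (cases "a e p \<ge> 0")
          case True
          then have "a e p * c p \<le> W * X"
            using c[OF p] X1 W(2)[OF e p] by (intro mult_mono) auto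
          then show ?thesis using True X1 W(1) by (simp add: min_def)
        next
          case False
          then have "a e p * c p \<le> 0" using c[OF p] by (simp add: mult_le_0_iff)
          moreover have "0 \<le> (a e p + W) * X" using W(2)[OF e p] X1 by simp
          ultimately show ?thesis using False by (simp add: min_def algebra_simps)
        qed
      qed
      also have "\<dots> = lo e + X * X"
        unfolding lo_def X_def by (simp add: sum.distrib algebra_simps)
      finally show ?thesis .
    qed
    ultimately show ?thesis by (auto simp: R_def \<Phi>_def)
  qed
  then have "\<Phi> ` S \<subseteq> R" by auto
  moreover have "card R < card S"
  proof -
    have "card R = nat (X * X + 1) ^ card E"
      unfolding R_def by (simp add: card_PiE fin)
    also have "\<dots> < (nat ((X + 1)^2)) ^ card E"
      using X1 cE by (intro power_strict_mono) (auto simp: power2_eq_square algebra_simps nat_less_eq_zless add_pos_nonneg)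
    also have "\<dots> = card S"
      unfolding S_def using X1 card by (simp add: card_PiE fin power_mult nat_power_eq)
    finally show ?thesis .
  qed
  moreover have "finite R" unfolding R_def by (intro finite_PiE fin) auto
  ultimately have "\<not> inj_on \<Phi> S" using card_inj_on_le[of \<Phi> S R] by auto
  then obtain c d where cd: "c \<in> S" "d \<in> S" "\<Phi> c = \<Phi> d" "c \<noteq> d" by (auto simp: inj_on_def)
  show ?thesis
  proof (rule that[of "\<lambda>p. c p - d p"])
    show "\<exists>p\<in>P. c p - d p \<noteq> 0"
      using cd PiE_ext[of c P "\<lambda>_. {0..X}" d] unfolding S_def by auto
    show "\<bar>c p - d p\<bar> \<le> int (card P) * W" if "p \<in> P" for p
      using cd(1,2) that unfolding S_def X_def[symmetric] by (fastforce simp: PiE_iff abs_le_iff)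
    show "(\<Sum>p\<in>P. a e p * (c p - d p)) = 0" if "e \<in> E" for e
      using fun_cong[OF cd(3), of e] that by (simp add: \<Phi>_def algebra_simps sum_subtractf)
  qed
qed

text \<open>Vandermonde independence: the hypothesis extends from powers to all polynomials, and the
  product over the other nodes isolates \<open>c p\<close>.\<close>

lemma power_sums_eq_0_imp_eq_0:
  fixes x c :: "'p \<Rightarrow> 'a :: field"
  assumes "finite P" "inj_on x P" "\<And>s. (\<Sum>p\<in>P. c p * x p ^ s) = 0" "p \<in> P"
  shows "c p = 0"
proof -
  have "(\<Sum>p\<in>P. c p * poly Q (x p)) = 0" for Q :: "'a poly"
  proof -
    have "(\<Sum>p\<in>P. c p * poly Q (x p)) = (\<Sum>p\<in>P. \<Sum>i\<le>degree Q. coeff Q i * (c p * x p ^ i))"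
      by (simp add: poly_altdef sum_distrib_left algebra_simps)
    also have "\<dots> = (\<Sum>i\<le>degree Q. coeff Q i * (\<Sum>p\<in>P. c p * x p ^ i))"
      by (subst sum.swap) (simp add: sum_distrib_left)
    finally show ?thesis using assms(3) by simp
  qed
  from this[of "\<Prod>p'\<in>P - {p}. [:- x p', 1:]"]
  have "(\<Sum>p''\<in>P. c p'' * (\<Prod>p'\<in>P - {p}. x p'' - x p')) = 0" by (simp add: poly_prod)
  moreover have "(\<Sum>p''\<in>P. c p'' * (\<Prod>p'\<in>P - {p}. x p'' - x p')) = c p * (\<Prod>p'\<in>P - {p}. x p - x p')"
    using assms(1,4) by (subst sum.remove[of _ p]) (auto intro!: sum.neutral prod_zero)
  moreover have "(\<Prod>p'\<in>P - {p}. x p - x p') \<noteq> 0"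
    using assms(1,2,4) by (auto simp: inj_on_def)
  ultimately show ?thesis by simp
qed

text \<open>With \<open>k = 3 * r\<close> this measures the gain from four interpolation nodes:
  \<open>fact (4 * r)\<close> exceeds \<open>fact r\<close> by a factor of at least
  \<open>r ^ (3 * r)\<close>.\<close>

lemma fact_mult_power_le_fact_add: "fact r * real r ^ k \<le> fact (r + k)"
proof (induction k)
  case (Suc k)
  have "fact r * real r ^ Suc k = real r * (fact r * real r ^ k)" by simp
  also have "\<dots> \<le> real (Suc (r + k)) * fact (r + k)"
    by (intro mult_mono Suc.IH) auto
  finally show ?case by simp
qed simp

text \<open>After squaring, the decisive power of \<open>L\<close> can be replaced through
  \<open>L ^ 2 \<le> 8 * N * r\<close>. The left side is then \<open>r ^ (6 * r)\<close>, the right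
  side \<open>r ^ (5 * r)\<close> times the r-th power of a constant; taking r-th roots leaves a
  single factor \<open>r\<close>.\<close>

lemma gelfond_growth:
  fixes r L N D C :: nat and t :: real
  assumes pos: "r \<ge> 1" "N \<ge> 1" "D \<ge> 1" "t \<ge> 0" and L: "L ^ 2 \<le> 8 * N * r"
    and le: "real r ^ (3 * r) \<le> 4 ^ (4 * r) * t ^ (3 * r) * real L ^ 4 * real D ^ (16 * L)
      * real (2 * L * C) ^ (5 * r)"
  shows "real r \<le> 4 ^ 8 * t ^ 6 * real (16 * N) ^ 4 * real D ^ (256 * N)
    * real (32 * N * C^2) ^ 5"
proof -
  define K where "K = 4 ^ 8 * t ^ 6 * real (16 * N) ^ 4 * real D ^ (256 * N)
    * real (32 * N * C^2) ^ 5"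
  have K0: "K \<ge> 0" unfolding K_def using pos by simp
  have "L \<le> L ^ 2" by (cases L) (auto simp: power2_eq_square)
  then have L8: "L \<le> 8 * N * r" using L by linarith
  \<comment> \<open>Polynomial factors are absorbed into r-th powers: \<open>8 * N\<close> is at
    most its own r-th power, and \<open>r < 2 ^ r\<close>.\<close>
  have L4: "real L ^ 8 \<le> (real (16 * N) ^ 4) ^ r"
  proof -
    have "8 * N * r \<le> (8 * N) ^ r * 2 ^ r"
      using pos self_le_power[of "8 * N" r] less_exp[of r] by (intro mult_mono) auto
    also have "\<dots> = (16 * N) ^ r" by (subst power_mult_distrib[symmetric]) simp
    finally have "L ^ 2 \<le> (16 * N) ^ r" using L by linarith
    then have "(L ^ 2) ^ 4 \<le> ((16 * N) ^ r) ^ 4" by (rule power_mono) simp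
    moreover have "((16 * N) ^ r) ^ 4 = ((16 * N) ^ 4) ^ r" "(L ^ 2) ^ 4 = L ^ 8"
      by (simp_all only: power_mult[symmetric] mult.commute[of r]) simp
    ultimately have "L ^ 8 \<le> ((16 * N) ^ 4) ^ r" by metis
    then show ?thesis by (metis of_nat_le_iff of_nat_power)
  qed
  have D: "real D ^ (32 * L) \<le> (real D ^ (256 * N)) ^ r"
    unfolding power_mult[symmetric] using pos L8 by (intro power_increasing) auto
  have LC: "(real (2 * L * C)) ^ (10 * r) \<le> (real (32 * N * C^2) ^ 5 * real r ^ 5) ^ r"
  proof -
    have "real (2 * L * C) ^ 2 = 4 * real C^2 * real (L^2)"
      by (simp add: power2_eq_square)
    also have "\<dots> \<le> 4 * real C^2 * real (8 * N * r)"
      using L by (intro mult_left_mono of_nat_mono) auto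
    also have "\<dots> = real (32 * N * C^2) * real r" by simp
    finally have "(real (2 * L * C) ^ 2) ^ (5 * r) \<le> (real (32 * N * C^2) * real r) ^ (5 * r)"
      by (rule power_mono) simp
    also have "\<dots> = (real (32 * N * C^2) ^ 5 * real r ^ 5) ^ r"
      unfolding power_mult power_mult_distrib ..
    finally show ?thesis
      unfolding power_mult[symmetric] by (simp only: mult.assoc[symmetric]) simp
  qed
  have sq: "x ^ (k * r) * x ^ (k * r) = (x ^ (2 * k)) ^ r" for x :: real and k
    by (simp only: power_add[symmetric] power_mult[symmetric]) (rule arg_cong[of _ _ "(^) x"], simp)
  have sq': "x ^ k * x ^ k = x ^ (2 * k)" for x :: real and k
    by (simp add: power_add[symmetric] mult_2)
  let ?R = "4 ^ (4 * r) * t ^ (3 * r) * real L ^ 4 * real D ^ (16 * L) * real (2 * L * C) ^ (5 * r)"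
  have "real r ^ (6 * r) = real r ^ (3 * r) * real r ^ (3 * r)" by (simp flip: power_add)
  also have "\<dots> \<le> ?R * ?R"
    using le pos by (intro mult_mono) auto
  also have "\<dots> = (4 ^ (4 * r) * 4 ^ (4 * r)) * (t ^ (3 * r) * t ^ (3 * r)) * (real L ^ 4 * real L ^ 4)
      * (real D ^ (16 * L) * real D ^ (16 * L)) * (real (2 * L * C) ^ (5 * r) * real (2 * L * C) ^ (5 * r))"
    by (simp only: mult_ac)
  also have "\<dots> = (4 ^ 8) ^ r * (t ^ 6) ^ r * real L ^ 8 * real D ^ (32 * L) * real (2 * L * C) ^ (10 * r)"
    unfolding sq unfolding sq' by (simp add: power_mult)
  also have "\<dots> \<le> (4 ^ 8) ^ r * (t ^ 6) ^ r * (real (16 * N) ^ 4) ^ r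
      * (real D ^ (256 * N)) ^ r * (real (32 * N * C^2) ^ 5 * real r ^ 5) ^ r"
    using L4 D LC pos by (intro mult_mono) auto
  also have "\<dots> = (K * real r ^ 5) ^ r"
    unfolding K_def power_mult_distrib of_nat_power by (simp only: mult_ac)
  finally have "(real r ^ 6) ^ r \<le> (K * real r ^ 5) ^ r" unfolding power_mult .
  then have "real r ^ 6 \<le> K * real r ^ 5"
    using pos K0 by (subst (asm) power_mono_iff) auto
  moreover have "real r ^ 6 = real r * real r ^ 5" by (simp flip: power_Suc)
  ultimately have "real r * real r ^ 5 \<le> K * real r ^ 5" by simp
  then show ?thesis using pos unfolding K_def by simp
qed

definition int_vec :: "real ^ 'n \<Rightarrow> bool" where
  "int_vec x \<longleftrightarrow> (\<forall>i. x $ i \<in> \<int>)"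

lemma int_vec_add: "int_vec x \<Longrightarrow> int_vec y \<Longrightarrow> int_vec (x + y)"
  by (simp add: int_vec_def)

lemma int_vec_scaleR: "c \<in> \<int> \<Longrightarrow> int_vec x \<Longrightarrow> int_vec (c *\<^sub>R x)"
  by (simp add: int_vec_def)

text \<open>The auxiliary function has \<open>L\<^sup>2 = 8NT\<close> unknown coefficients, twice the number of equations for
  vanishing to order \<open>T\<close> at \<open>0, 1, 2, 3\<close>. If \<open>r \<ge> T\<close> is its exact vanishing order there, the
  interpolation bound beats the common denominator: comparing \<open>r ^ (3r)\<close> with \<open>c ^ r * L ^ (5r)\<close>,
  where \<open>L\<^sup>2 \<le> 8Nr\<close>, bounds \<open>r\<close>; with fewer than four points it would not.\<close>

theorem gelfond_schneider_vector:
  fixes A B :: "real ^ 'n \<Rightarrow> real ^ 'n" and \<xi> :: "nat \<Rightarrow> nat \<Rightarrow> real \<Rightarrow> real ^ 'n"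
    and \<omega> :: "real ^ 'n \<Rightarrow> complex" and \<tau> :: real and D :: nat
  assumes lin: "linear A" "linear B" "linear \<omega>"
    and int: "\<And>x. int_vec x \<Longrightarrow> int_vec (A x)" "\<And>x. int_vec x \<Longrightarrow> int_vec (B x)"
    and der: "\<And>k l z. (\<xi> k l has_vector_derivative
        \<tau> *\<^sub>R (real k *\<^sub>R A (\<xi> k l z) + real l *\<^sub>R B (\<xi> k l z))) (at z)"
    and norm_le: "\<And>k l z. norm (\<xi> k l z) \<le> 1"
    and D: "D \<ge> 1" "\<And>k l m. int_vec (real D ^ ((k + l) * m) *\<^sub>R \<xi> k l (real m))"
    and \<omega>: "\<And>x. \<omega> (A x) = \<alpha> * \<omega> x" "\<And>x. \<omega> (B x) = \<beta> * \<omega> x" "\<And>k l. \<omega> (\<xi> k l 0) = \<kappa>" "\<kappa> \<noteq> 0"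
    and \<tau>: "\<tau> \<noteq> 0"
  shows "\<exists>a b :: int. (a, b) \<noteq> (0, 0) \<and> of_int a * \<alpha> + of_int b * \<beta> = 0"
proof (rule ccontr)
  assume "\<not> ?thesis"
  then have indep: "a = 0 \<and> b = 0" if "of_int a * \<alpha> + of_int b * \<beta> = 0" for a b :: int
    using that by auto
  define N where "N = CARD('n)"
  have N: "N \<ge> 1" unfolding N_def by (simp add: Suc_leI)
  obtain C where C: "C \<ge> 1" "\<And>x. norm (A x) \<le> real C * norm x" "\<And>x. norm (B x) \<le> real C * norm x"
  proof -
    obtain a where a: "\<And>x. norm (A x) \<le> a * norm x"
      using linear_bounded[OF lin(1)] by blast
    obtain b where b: "\<And>x. norm (B x) \<le> b * norm x"
      using linear_bounded[OF lin(2)] by blast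
    define C where "C = nat \<lceil>max 1 (max a b)\<rceil>"
    have "max 1 (max a b) \<le> real C" unfolding C_def by linarith
    then have *: "1 \<le> real C" "a \<le> real C" "b \<le> real C" by auto
    show ?thesis
    proof (rule that[of C])
      show "norm (A x) \<le> real C * norm x" for x
        using * by (intro order_trans[OF a] mult_right_mono) auto
      show "norm (B x) \<le> real C * norm x" for x
        using * by (intro order_trans[OF b] mult_right_mono) auto
    qed (use * in auto)
  qed
  \<comment> \<open>\<open>M p\<close> generates the curve \<open>\<xi> k l\<close> for
    \<open>p = (k, l)\<close>. The real number \<open>\<tau>\<close> is kept out, so that
    \<open>M p\<close> preserves integral vectors and \<open>V s p\<close> is the s-th derivative
    divided by \<open>\<tau> ^ s\<close>; the missing factor returns in \<open>f\<close>
    below.\<close>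
  define M where "M p x = real (fst p) *\<^sub>R A x + real (snd p) *\<^sub>R B x" for p :: "nat \<times> nat" and x
  have linM: "linear (M p)" for p
    unfolding M_def by (intro linear_compose_add linear_compose_scale_right lin)
  have intM: "int_vec ((M p ^^ s) x)" if "int_vec x" for p s x
    using that by (induction s) (auto simp: M_def intro!: int_vec_add int_vec_scaleR int)
  define V where "V s p z = (M p ^^ s) (\<xi> (fst p) (snd p) z)" for s p z
  have derV: "(V s p has_vector_derivative \<tau> *\<^sub>R V (Suc s) p z) (at z)" for s p z
  proof -
    have "bounded_linear (M p ^^ s)"
      using linear_funpow[OF linM] by (simp add: linear_conv_bounded_linear)
    from bounded_linear.has_vector_derivative[OF this der[of "fst p" "snd p" z]]
    show ?thesis
      unfolding V_def M_def[symmetric]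
      by (simp add: linear_scale[OF linear_funpow[OF linM]] funpow_swap1)
  qed
  have \<omega>V: "\<omega> (V s p 0) = (of_nat (fst p) * \<alpha> + of_nat (snd p) * \<beta>) ^ s * \<kappa>" for s p
  proof -
    have "\<omega> (M p x) = (of_nat (fst p) * \<alpha> + of_nat (snd p) * \<beta>) * \<omega> x" for x
      unfolding M_def by (simp add: linear_add[OF lin(3)] linear_scale[OF lin(3)] \<omega> algebra_simps
          scaleR_conv_of_real[where 'a = complex])
    then have "\<omega> ((M p ^^ s) x) = (of_nat (fst p) * \<alpha> + of_nat (snd p) * \<beta>) ^ s * \<omega> x" for x
      by (induction s) auto
    then show ?thesis unfolding V_def by (simp add: \<omega>)
  qed
  define K where "K = 4 ^ 8 * \<bar>\<tau>\<bar> ^ 6 * real (16 * N) ^ 4 * real D ^ (256 * N)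
    * real (32 * N * C^2) ^ 5"
  \<comment> \<open>\<open>K\<close> is the bound that \<open>gelfond_growth\<close> will put on the
    vanishing order \<open>r\<close>; since \<open>r \<ge> T \<ge> q > K\<close>, this is the final
    contradiction. Expressing \<open>L\<close> and \<open>T\<close> through \<open>q\<close> makes
    \<open>L ^ 2 = 8 * N * T\<close> exact, without rounding.\<close>
  define q where "q = nat \<lceil>K\<rceil> + 1"
  have q: "real q > K" "q \<ge> 1" unfolding q_def by linarith+
  define L where "L = 4 * N * q"
  define T where "T = 2 * N * q ^ 2"
  define P where "P = {..<L} \<times> {..<L}"
  have P: "finite P" "card P = L ^ 2" unfolding P_def by (auto simp: power2_eq_square)
  have normV: "norm (V s p z) \<le> real (2 * L * C) ^ s" if "p \<in> P" for s p z
  proof (induction s)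
    case 0
    then show ?case unfolding V_def by (simp add: norm_le)
  next
    case (Suc s)
    have "norm (M p x) \<le> real (2 * L * C) * norm x" for x
    proof -
      have "norm (M p x) \<le> real (fst p) * norm (A x) + real (snd p) * norm (B x)"
        unfolding M_def by (rule order_trans[OF norm_triangle_ineq]) simp
      also have "\<dots> \<le> real L * (real C * norm x) + real L * (real C * norm x)"
        using that C by (intro add_mono mult_mono) (auto simp: P_def)
      finally show ?thesis by (simp add: mult_ac)
    qed
    from this[of "V s p z"] show ?case
      using mult_left_mono[OF Suc, of "real (2 * L * C)"] unfolding V_def by simp
  qed
  define W where "W = int (D ^ (8 * L) * (2 * L * C) ^ T)"
  have W_real: "real_of_int W = real D ^ (8 * L) * real (2 * L * C) ^ T" unfolding W_def by simp
  define E where "E = {..<4::nat} \<times> {..<T} \<times> (UNIV :: 'n set)"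
  have "L \<ge> 1" "T \<ge> 1" unfolding L_def T_def using N q by auto
  have W1: "W \<ge> 1" unfolding W_def using D(1) C(1) \<open>L \<ge> 1\<close> by (simp add: Suc_leI flip: of_nat_mult of_nat_power)
  have E: "finite E" "card P = 2 * card E" "E \<noteq> {}"
    unfolding E_def P using \<open>T \<ge> 1\<close>
    by (auto simp: card_cartesian_product L_def T_def N_def power2_eq_square lessThan_empty_iff)
  \<comment> \<open>With \<open>k, l < L\<close> and \<open>m \<le> 3\<close> the exponent
    \<open>(k + l) * m\<close> is at most \<open>6 * L\<close>, so \<open>8 * L\<close> clears all
    denominators at once.\<close>
  have intV: "real D ^ (8 * L) * V s p (real m) $ i \<in> \<int>" if "p \<in> P" "m < 4" for s p m i
  proof -
    obtain k l where p: "p = (k, l)" "k < L" "l < L" using \<open>p \<in> P\<close> unfolding P_def by auto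
    have "(k + l) * m \<le> (2 * L) * 3" using p that by (intro mult_mono) auto
    then have "real D ^ (8 * L) = real D ^ (8 * L - (k + l) * m) * real D ^ ((k + l) * m)"
      by (simp flip: power_add)
    then have "int_vec (real D ^ (8 * L) *\<^sub>R \<xi> k l (real m))"
      using int_vec_scaleR[OF _ D(2)[of k l m], of "real D ^ (8 * L - (k + l) * m)"] by simp
    then have "int_vec ((M p ^^ s) (real D ^ (8 * L) *\<^sub>R \<xi> k l (real m)))" by (rule intM)
    then show ?thesis
      unfolding V_def int_vec_def by (simp add: linear_scale[OF linear_funpow[OF linM]] p)
  qed
  \<comment> \<open>The floor only changes the type: by \<open>intV\<close> these numbers are
    integers wherever they are used.\<close>
  define a where "a = (\<lambda>(m, s, i) p. \<lfloor>real D ^ (8 * L) * V s p (real m) $ i\<rfloor>)"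
  have a: "real_of_int (a (m, s, i) p) = real D ^ (8 * L) * V s p (real m) $ i"
    if "p \<in> P" "m < 4" for m s i p
    unfolding a_def using of_int_floor[OF intV[OF that, of s i]] by simp
  obtain c where c: "\<exists>p\<in>P. c p \<noteq> 0" "\<And>p. p \<in> P \<Longrightarrow> \<bar>c p\<bar> \<le> int (card P) * W"
    "\<And>e. e \<in> E \<Longrightarrow> (\<Sum>p\<in>P. a e p * c p) = 0"
  proof (rule siegel_small_solution[OF E(1) P(1) E(2,3) W1, of a])
    show "\<bar>a e p\<bar> \<le> W" if e: "e \<in> E" and p: "p \<in> P" for e p
    proof -
      obtain m s i where e': "e = (m, s, i)" "m < 4" "s < T" using e unfolding E_def by auto
      have "\<bar>V s p (real m) $ i\<bar> \<le> real (2 * L * C) ^ s"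
        using order_trans[OF component_le_norm_cart normV[OF p]] .
      also have "\<dots> \<le> real (2 * L * C) ^ T"
        using C(1) \<open>L \<ge> 1\<close> e' by (intro power_increasing) (auto simp: Suc_leI simp flip: of_nat_mult)
      finally have "\<bar>real_of_int (a e p)\<bar> \<le> real D ^ (8 * L) * real (2 * L * C) ^ T"
        unfolding e'(1) a[OF p e'(2)] abs_mult by (intro mult_mono) auto
      then show ?thesis unfolding W_real[symmetric] by linarith
    qed
  qed (rule that)
  define G where "G s z = (\<Sum>p\<in>P. real_of_int (c p) *\<^sub>R V s p z)" for s z
  have Ga: "real D ^ (8 * L) * G s (real m) $ i = real_of_int (\<Sum>p\<in>P. a (m, s, i) p * c p)"
    if "m < 4" for s m i
    unfolding G_def using a[OF _ that] by (simp add: sum_distrib_left mult_ac)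
  have GT: "G s (real m) = 0" if "s < T" "m < 4" for s m
  proof -
    have "real D ^ (8 * L) * G s (real m) $ i = 0" for i
      unfolding Ga[OF that(2)] using c(3)[of "(m, s, i)"] that by (simp add: E_def)
    then show ?thesis using D(1) by (auto simp: vec_eq_iff)
  qed
  \<comment> \<open>The node 0 alone suffices: if all derivatives vanished there,
    \<open>\<omega>\<close> would give vanishing power sums with nodes
    \<open>k * \<alpha> + l * \<beta>\<close>. These are distinct by independence, so every
    \<open>c p\<close> would be 0.\<close>
  have "\<exists>s. \<exists>m<4. G s (real m) \<noteq> 0"
  proof (rule ccontr)
    assume "\<not> ?thesis"
    then have G0: "G s 0 = 0" for s by (metis of_nat_0 zero_less_numeral)
    define x where "x p = of_nat (fst p) * \<alpha> + of_nat (snd p) * \<beta>" for p :: "nat \<times> nat"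
    have inj: "inj_on x P"
    proof (rule inj_onI)
      fix p p' assume "x p = x p'"
      then have "of_int (int (fst p) - int (fst p')) * \<alpha> + of_int (int (snd p) - int (snd p')) * \<beta> = 0"
        unfolding x_def by (simp add: algebra_simps)
      from indep[OF this] show "p = p'" by (auto simp: prod_eq_iff)
    qed
    have sum0: "(\<Sum>p\<in>P. of_int (c p) * x p ^ s) = 0" for s
    proof -
      have "0 = \<omega> (G s 0)" using G0 linear_0[OF lin(3)] by simp
      also have "\<dots> = (\<Sum>p\<in>P. of_int (c p) * x p ^ s) * \<kappa>"
        unfolding G_def x_def
        by (simp add: linear_sum[OF lin(3)] linear_scale[OF lin(3)] \<omega>V scaleR_conv_of_real[where 'a = complex]
            sum_distrib_right mult.assoc)
      finally show ?thesis using \<omega>(4) by simp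
    qed
    from power_sums_eq_0_imp_eq_0[OF P(1) inj sum0] have "\<forall>p\<in>P. c p = 0" by simp
    then show False using c(1) by blast
  qed
  then obtain r where r: "\<exists>m<4. G r (real m) \<noteq> 0" and r_min: "\<forall>s<r. \<not> (\<exists>m<4. G s (real m) \<noteq> 0)"
    unfolding exists_least_iff[of "\<lambda>s. \<exists>m<4. G s (real m) \<noteq> 0"] by blast
  have Tr: "T \<le> r" using r GT not_less by blast
  obtain m i where m: "m < 4" and i: "G r (real m) $ i \<noteq> 0"
    using r by (auto simp: vec_eq_iff)
  define f where "f s z = \<tau> ^ s * G s z $ i" for s z
  have derf: "(f s has_real_derivative f (Suc s) z) (at z)" for s z
  proof -
    have "(G s has_vector_derivative (\<Sum>p\<in>P. real_of_int (c p) *\<^sub>R (\<tau> *\<^sub>R V (Suc s) p z))) (at z)"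
      unfolding G_def by (intro has_vector_derivative_sum
          bounded_linear.has_vector_derivative[OF bounded_linear_scaleR_right derV])
    then have "(G s has_vector_derivative \<tau> *\<^sub>R G (Suc s) z) (at z)"
      unfolding G_def by (simp add: scaleR_sum_right mult.commute)
    from bounded_linear.has_vector_derivative[OF bounded_linear_vec_nth[of i] this]
    have "((\<lambda>z. G s z $ i) has_real_derivative \<tau> * G (Suc s) z $ i) (at z)"
      by (simp add: has_real_derivative_iff_has_vector_derivative)
    from DERIV_cmult[OF this, of "\<tau> ^ s"] show ?thesis unfolding f_def by (simp add: mult_ac)
  qed
  define X where "X = real (L ^ 2) * real_of_int W"
  define Bd where "Bd = \<bar>\<tau>\<bar> ^ (4 * r) * (real (L ^ 2) * X * real (2 * L * C) ^ (4 * r))"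
  have bound: "\<bar>f (4 * r) z\<bar> \<le> Bd" for z
  proof -
    have "norm (G (4 * r) z) \<le> (\<Sum>p\<in>P. X * real (2 * L * C) ^ (4 * r))"
      unfolding G_def
    proof (rule sum_norm_le)
      fix p assume p: "p \<in> P"
      have "\<bar>real_of_int (c p)\<bar> \<le> X"
        using c(2)[OF p] unfolding X_def P by (metis of_int_abs of_int_le_iff of_int_mult of_int_of_nat_eq)
      then show "norm (real_of_int (c p) *\<^sub>R V (4 * r) p z) \<le> X * real (2 * L * C) ^ (4 * r)"
        unfolding norm_scaleR using normV[OF p] W1 by (intro mult_mono) (auto simp: X_def)
    qed
    also have "\<dots> = real (L ^ 2) * X * real (2 * L * C) ^ (4 * r)" by (simp add: P)
    finally have "\<bar>G (4 * r) z $ i\<bar> \<le> real (L ^ 2) * X * real (2 * L * C) ^ (4 * r)"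
      using component_le_norm_cart order_trans by blast
    then show ?thesis unfolding f_def Bd_def abs_mult power_abs[symmetric]
      by (intro mult_mono) auto
  qed
  have "\<bar>f r (real m)\<bar> * fact (4 * r) \<le> fact r * 4 ^ (4 * r) * Bd"
    using interpolation_derivative_bound[of f r 4 Bd m] derf bound m r_min
    by (auto simp: f_def)
  \<comment> \<open>The arithmetic lower bound: with denominators cleared, the chosen entry is a
    nonzero integer.\<close>
  moreover have "\<bar>\<tau>\<bar> ^ r \<le> real D ^ (8 * L) * \<bar>f r (real m)\<bar>"
  proof -
    have "real D ^ (8 * L) * G r (real m) $ i \<noteq> 0" using i D(1) by simp
    moreover have "1 \<le> \<bar>real_of_int k\<bar>" if "real_of_int k \<noteq> 0" for k
      using that by (cases k rule: int_cases3) auto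
    ultimately have "1 \<le> \<bar>real D ^ (8 * L) * G r (real m) $ i\<bar>"
      unfolding Ga[OF m] by blast
    from mult_left_mono[OF this, of "\<bar>\<tau>\<bar> ^ r"] show ?thesis
      by (simp add: f_def abs_mult power_abs mult_ac)
  qed
  ultimately have "\<bar>\<tau>\<bar> ^ r * fact (4 * r) \<le> real D ^ (8 * L) * (fact r * 4 ^ (4 * r) * Bd)"
    by (smt (verit, best) fact_ge_zero mult.assoc mult_left_mono mult_right_mono of_nat_0_le_iff zero_le_power)
  also have "Bd = \<bar>\<tau>\<bar> ^ r * (\<bar>\<tau>\<bar> ^ (3 * r) * (real (L ^ 2) * X * real (2 * L * C) ^ (4 * r)))"
    unfolding Bd_def by (simp flip: power_add mult.assoc)
  finally have "fact (4 * r) * \<bar>\<tau>\<bar> ^ r \<le> (fact r * (4 ^ (4 * r) * \<bar>\<tau>\<bar> ^ (3 * r) * real (L ^ 2) * X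
      * real D ^ (8 * L) * real (2 * L * C) ^ (4 * r))) * \<bar>\<tau>\<bar> ^ r"
    by (simp add: mult_ac)
  then have "fact (4 * r) \<le> fact r * (4 ^ (4 * r) * \<bar>\<tau>\<bar> ^ (3 * r) * real (L ^ 2) * X
      * real D ^ (8 * L) * real (2 * L * C) ^ (4 * r))"
    using \<tau> by (simp only: mult_le_cancel_right) auto
  moreover have "fact r * real r ^ (3 * r) \<le> fact (4 * r)"
    using fact_mult_power_le_fact_add[of r "3 * r"] by simp
  ultimately have "fact r * real r ^ (3 * r) \<le> fact r * (4 ^ (4 * r) * \<bar>\<tau>\<bar> ^ (3 * r) * real (L ^ 2) * X
      * real D ^ (8 * L) * real (2 * L * C) ^ (4 * r))" by linarith
  then have "real r ^ (3 * r) \<le> 4 ^ (4 * r) * \<bar>\<tau>\<bar> ^ (3 * r) * real (L ^ 2) * X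
      * real D ^ (8 * L) * real (2 * L * C) ^ (4 * r)"
    by (simp only: mult_le_cancel_left) auto
  also have "\<dots> = 4 ^ (4 * r) * \<bar>\<tau>\<bar> ^ (3 * r) * (real L ^ 2 * real L ^ 2)
      * (real D ^ (8 * L) * real D ^ (8 * L)) * (real (2 * L * C) ^ T * real (2 * L * C) ^ (4 * r))"
    unfolding X_def W_real by (simp only: of_nat_power mult_ac)
  \<comment> \<open>The factor with exponent \<open>T\<close> comes from the size of Siegel's
    solution, the one with \<open>4 * r\<close> from the derivative bound; \<open>T \<le> r\<close>
    merges them into exponent \<open>5 * r\<close>.\<close>
  also have "\<dots> \<le> 4 ^ (4 * r) * \<bar>\<tau>\<bar> ^ (3 * r) * (real L ^ 4)
      * (real D ^ (16 * L)) * real (2 * L * C) ^ (5 * r)"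
  proof -
    have "1 \<le> real (2 * L * C)" using C(1) \<open>L \<ge> 1\<close> by (simp add: Suc_leI flip: of_nat_mult)
    then have "real (2 * L * C) ^ T * real (2 * L * C) ^ (4 * r) \<le> real (2 * L * C) ^ (5 * r)"
      unfolding power_add[symmetric] using Tr by (intro power_increasing) auto
    then show ?thesis
      unfolding power_add[symmetric] by (intro mult_mono) auto
  qed
  finally have growth: "real r ^ (3 * r) \<le> 4 ^ (4 * r) * \<bar>\<tau>\<bar> ^ (3 * r) * real L ^ 4
      * real D ^ (16 * L) * real (2 * L * C) ^ (5 * r)" .
  have "r \<ge> 1" using Tr \<open>T \<ge> 1\<close> by linarith
  have "L ^ 2 = 8 * N * T" by (simp add: L_def T_def power2_eq_square)
  then have "L ^ 2 \<le> 8 * N * r" using Tr by simp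
  from gelfond_growth[OF \<open>r \<ge> 1\<close> N D(1) _ this growth] have "real r \<le> K"
    unfolding K_def by simp
  moreover have "q \<le> r"
  proof -
    have "q \<le> q ^ 2" by (simp add: power2_eq_square)
    also have "\<dots> \<le> T" unfolding T_def using N by simp
    finally show ?thesis using Tr by simp
  qed
  ultimately show False using q by linarith
qed

section \<open>Self-adjoint maps\<close>

text \<open>A maximum of the Rayleigh quotient on the compact unit sphere of \<open>V\<close> is an
  eigenvector: otherwise moving along the residual \<open>f x - \<mu> *\<^sub>R x\<close> would
  increase the quotient to first order.\<close>

lemma selfadjoint_eigenvector_exists:
  fixes f :: "'a :: euclidean_space \<Rightarrow> 'a"
  assumes f: "linear f" "\<And>x y. f x \<bullet> y = x \<bullet> f y"
    and V: "subspace V" "f ` V \<subseteq> V" "V \<noteq> {0}"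
  obtains x \<mu> where "x \<in> V" "norm x = 1" "f x = \<mu> *\<^sub>R x"
proof -
  define S where "S = V \<inter> sphere 0 1"
  have "compact S"
    unfolding S_def using closed_subspace[OF V(1)] by (simp add: closed_Int_compact)
  moreover have "S \<noteq> {}"
  proof -
    obtain v where "v \<in> V" "v \<noteq> 0" using V(3) subspace_0[OF V(1)] by auto
    then have "(1 / norm v) *\<^sub>R v \<in> S"
      unfolding S_def using subspace_scale[OF V(1)] by auto
    then show ?thesis by auto
  qed
  moreover have "continuous_on S (\<lambda>x. f x \<bullet> x)"
    by (intro continuous_intros linear_continuous_on_compose[OF continuous_on_id f(1)])
  ultimately obtain x where x: "x \<in> S" and max: "\<And>y. y \<in> S \<Longrightarrow> f y \<bullet> y \<le> f x \<bullet> x"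
    using continuous_attains_sup[of S "\<lambda>x. f x \<bullet> x"] by auto
  define \<mu> where "\<mu> = f x \<bullet> x"
  have x1: "x \<in> V" "norm x = 1" "x \<bullet> x = 1" using x by (auto simp: S_def norm_eq_1)
  have le: "f y \<bullet> y \<le> \<mu> * (y \<bullet> y)" if "y \<in> V" for y
  proof (cases "y = 0")
    case True
    then show ?thesis using linear_0[OF f(1)] by simp
  next
    case False
    then have "(1 / norm y) *\<^sub>R y \<in> S"
      unfolding S_def using subspace_scale[OF V(1)] that by auto
    from max[OF this] False show ?thesis
      by (simp add: linear_scale[OF f(1)] \<mu>_def dot_square_norm power2_eq_square field_simps)
  qed
  define w where "w = f x - \<mu> *\<^sub>R x"
  have wV: "w \<in> V" unfolding w_def using V x1 by (auto intro: subspace_diff subspace_scale)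
  have xw: "x \<bullet> w = 0" unfolding w_def using x1 by (simp add: inner_diff_right \<mu>_def inner_commute)
  have "f x = w + \<mu> *\<^sub>R x" unfolding w_def by simp
  then have fxw: "f x \<bullet> w = w \<bullet> w" using xw by (simp add: inner_add_left)
  \<comment> \<open>Maximality is tested on \<open>x + t *\<^sub>R w\<close>: the gain is linear in
    \<open>t\<close> and the possible loss quadratic, so small positive \<open>t\<close> forces
    \<open>w = 0\<close>.\<close>
  have "2 * t * (w \<bullet> w) \<le> t\<^sup>2 * (\<mu> * (w \<bullet> w) - f w \<bullet> w)" for t :: real
  proof -
    have "f (x + t *\<^sub>R w) \<bullet> (x + t *\<^sub>R w) = \<mu> + 2 * t * (w \<bullet> w) + t\<^sup>2 * (f w \<bullet> w)"
      using fxw f(2)[of w x] by (simp add: linear_add[OF f(1)] linear_scale[OF f(1)] inner_add_left inner_add_right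
          \<mu>_def power2_eq_square inner_commute algebra_simps)
    moreover have "(x + t *\<^sub>R w) \<bullet> (x + t *\<^sub>R w) = 1 + t\<^sup>2 * (w \<bullet> w)"
      using xw x1 by (simp add: inner_add_left inner_add_right power2_eq_square inner_commute)
    moreover have "x + t *\<^sub>R w \<in> V" using x1 wV V by (auto intro: subspace_add subspace_scale)
    ultimately show ?thesis using le[of "x + t *\<^sub>R w"] by (simp add: algebra_simps)
  qed
  note * = this
  define c where "c = \<mu> * (w \<bullet> w) - f w \<bullet> w"
  have "w \<bullet> w \<le> 0"
  proof (rule ccontr)
    assume "\<not> w \<bullet> w \<le> 0"
    then have p: "w \<bullet> w > 0" by linarith
    \<comment> \<open>Chosen so that multiplying by \<open>\<bar>c\<bar> + 1\<close> gives back
      \<open>w \<bullet> w\<close>, half of what maximality would require.\<close>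
    define t where "t = (w \<bullet> w) / (\<bar>c\<bar> + 1)"
    have t: "t > 0" unfolding t_def using p by simp
    have "t * (2 * (w \<bullet> w)) \<le> t * (t * c)" using *[of t] unfolding c_def[symmetric] by (simp add: power2_eq_square mult_ac)
    then have "2 * (w \<bullet> w) \<le> t * c" using t by simp
    also have "\<dots> \<le> t * (\<bar>c\<bar> + 1)" using t by (intro mult_left_mono) auto
    also have "\<dots> = w \<bullet> w" unfolding t_def by simp
    finally show False using p by simp
  qed
  then have "w = 0" using inner_gt_zero_iff[of w] by linarith
  then show ?thesis using that[of x \<mu>] x1 unfolding w_def by simp
qed

text \<open>Induction on the dimension of an invariant subspace; self-adjointness makes the
  orthogonal complement of an eigenvector invariant again.\<close>

lemma selfadjoint_orthonormal_eigenbasis: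
  fixes f :: "'a :: euclidean_space \<Rightarrow> 'a"
  assumes f: "linear f" "\<And>x y. f x \<bullet> y = x \<bullet> f y"
  obtains B ev where "finite B" "card B = DIM('a)" "span B = UNIV" "pairwise orthogonal B"
    "\<And>b. b \<in> B \<Longrightarrow> norm b = 1" "\<And>b. b \<in> B \<Longrightarrow> f b = ev b *\<^sub>R b"
proof -
  have "\<exists>B. B \<subseteq> V \<and> pairwise orthogonal B \<and> (\<forall>b\<in>B. norm b = 1) \<and> V \<subseteq> span B \<and> (\<forall>b\<in>B. \<exists>\<mu>. f b = \<mu> *\<^sub>R b)"
    if "subspace V" "f ` V \<subseteq> V" "dim V = n" for V n
    using that
  proof (induction n arbitrary: V)
    case 0
    then show ?case by (intro exI[of _ "{}"]) auto
  next
    case (Suc n)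
    have "V \<noteq> {0}" using Suc.prems(3) by auto
    then obtain x \<mu> where x: "x \<in> V" "norm x = 1" "f x = \<mu> *\<^sub>R x"
      using selfadjoint_eigenvector_exists[OF f Suc.prems(1,2)] by metis
    define U where "U = V \<inter> {y. x \<bullet> y = 0}"
    have xx: "x \<bullet> x = 1" using x(2) by (simp add: norm_eq_1)
    have U: "subspace U"
      unfolding U_def using Suc.prems(1) by (intro subspace_inter) (auto simp: subspace_hyperplane)
    have "f ` U \<subseteq> U"
      unfolding U_def using Suc.prems(2) x(3) by (auto simp: f(2)[of x, symmetric])
    moreover have ins: "V \<subseteq> span (insert x U)" 
    proof
      fix v assume v: "v \<in> V"
      have "v - (x \<bullet> v) *\<^sub>R x \<in> U"
        unfolding U_def using v x xx Suc.prems(1)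
        by (auto intro!: subspace_diff subspace_scale simp: inner_diff_right)
      then show "v \<in> span (insert x U)"
        using span_breakdown_eq[of v x U] span_base by blast
    qed
    have "dim U = n"
    proof -
      have "x \<notin> span U" using U xx by (simp add: span_eq_iff[THEN iffD2]) (auto simp: U_def)
      then have "dim (insert x U) = Suc (dim U)" by (simp add: dim_insert)
      moreover have "dim (insert x U) = dim V"
      proof (rule antisym)
        show "dim (insert x U) \<le> dim V" using x by (intro dim_subset) (auto simp: U_def)
        show "dim V \<le> dim (insert x U)" using ins by (metis dim_span dim_subset)
      qed
      ultimately show ?thesis using Suc.prems(3) by simp
    qed
    ultimately obtain B where B: "B \<subseteq> U" "pairwise orthogonal B" "\<forall>b\<in>B. norm b = 1" "U \<subseteq> span B"
      "\<forall>b\<in>B. \<exists>\<mu>. f b = \<mu> *\<^sub>R b"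
      using Suc.IH[OF U] by blast
    show ?case
    proof (intro exI[of _ "insert x B"] conjI)
      show "insert x B \<subseteq> V" using B(1) x(1) by (auto simp: U_def)
      show "pairwise orthogonal (insert x B)"
        using B(1,2) by (auto simp: pairwise_insert U_def orthogonal_def inner_commute)
      have "insert x U \<subseteq> span (insert x B)"
        using B(4) span_mono[of B "insert x B"] by (auto intro: span_base)
      then show "V \<subseteq> span (insert x B)" using ins span_minimal subspace_span by blast
    qed (use B x in auto)
  qed
  from this[of UNIV "DIM('a)"] obtain B where B: "pairwise orthogonal B" "\<forall>b\<in>B. norm b = 1"
    "UNIV \<subseteq> span B" "\<forall>b\<in>B. \<exists>\<mu>. f b = \<mu> *\<^sub>R b" by (auto simp: dim_UNIV)
  have "independent B" using B(1,2) by (intro pairwise_orthogonal_independent) force+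
  then have "finite B" "card B = DIM('a)"
    using B(3) dim_eq_card[of B UNIV] by (auto simp: independent_imp_finite top.extremum_unique)
  moreover obtain ev where "\<And>b. b \<in> B \<Longrightarrow> f b = ev b *\<^sub>R b" using B(4) by metis
  ultimately show ?thesis using that[of B ev] B by blast
qed

lemma orthonormal_basis_expand:
  fixes B :: "'a :: euclidean_space set"
  assumes "finite B" "span B = UNIV" "pairwise orthogonal B" "\<And>b. b \<in> B \<Longrightarrow> norm b = 1"
  shows "(\<Sum>b\<in>B. (x \<bullet> b) *\<^sub>R b) = x"
proof (rule sym, rule vector_eq_dot_span[of _ B])
  fix b assume b: "b \<in> B"
  have "b \<bullet> (\<Sum>c\<in>B. (x \<bullet> c) *\<^sub>R c) = (\<Sum>c\<in>B. (x \<bullet> c) * (b \<bullet> c))"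
    by (simp add: inner_sum_right)
  also have "\<dots> = (x \<bullet> b) * (b \<bullet> b)"
  proof -
    have "b \<bullet> c = 0" if "c \<in> B - {b}" for c
      using pairwiseD[OF assms(3) b] that by (auto simp: orthogonal_def)
    then show ?thesis using assms(1) b by (simp add: sum.remove[of _ b])
  qed
  finally show "b \<bullet> x = b \<bullet> (\<Sum>c\<in>B. (x \<bullet> c) *\<^sub>R c)"
    using assms(4)[OF b] by (simp add: norm_eq_1 inner_commute)
qed (use assms in auto)

lemma trace_orthonormal_basis:
  fixes B :: "'a :: euclidean_space set"
  assumes B: "finite B" "span B = UNIV" "pairwise orthogonal B" "\<And>b. b \<in> B \<Longrightarrow> norm b = 1"
    and g: "linear g"
  shows "(\<Sum>b\<in>B. g b \<bullet> b) = (\<Sum>e\<in>Basis. g e \<bullet> e)"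
proof -
  have "(\<Sum>e\<in>Basis. g e \<bullet> e) = (\<Sum>e\<in>Basis. \<Sum>b\<in>B. (e \<bullet> b) * (g b \<bullet> e))"
  proof (rule sum.cong[OF refl])
    fix e :: 'a
    have "g e = (\<Sum>b\<in>B. (e \<bullet> b) *\<^sub>R g b)"
    proof -
      have "g e = g (\<Sum>b\<in>B. (e \<bullet> b) *\<^sub>R b)" by (simp only: orthonormal_basis_expand[OF B])
      also have "\<dots> = (\<Sum>b\<in>B. g ((e \<bullet> b) *\<^sub>R b))" by (rule linear_sum[OF g])
      finally show ?thesis by (simp add: linear_scale[OF g])
    qed
    then show "g e \<bullet> e = (\<Sum>b\<in>B. (e \<bullet> b) * (g b \<bullet> e))" by (simp add: inner_sum_left)
  qed
  also have "\<dots> = (\<Sum>b\<in>B. \<Sum>e\<in>Basis. (g b \<bullet> e) * (b \<bullet> e))"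
    by (subst sum.swap) (simp add: inner_commute mult.commute)
  also have "\<dots> = (\<Sum>b\<in>B. g b \<bullet> b)" by (simp add: euclidean_inner[symmetric])
  finally show ?thesis by simp
qed

text \<open>Along an orthonormal eigenbasis every eigenvalue occurs \<open>d\<close> times, and the
  trace does not depend on the basis. The uniform multiplicity \<open>d\<close> is kept general
  because a complex matrix will be treated as a real-linear map, which doubles the dimension of each
  eigenspace.\<close>

lemma selfadjoint_power_sums:
  fixes f :: "'a :: euclidean_space \<Rightarrow> 'a"
  assumes f: "linear f" "\<And>x y. f x \<bullet> y = x \<bullet> f y"
    and dim: "\<And>\<mu>. (\<exists>x. x \<noteq> 0 \<and> f x = \<mu> *\<^sub>R x) \<Longrightarrow> dim {x. f x = \<mu> *\<^sub>R x} = d"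
  defines "\<Lambda> \<equiv> {\<mu>. \<exists>x. x \<noteq> 0 \<and> f x = \<mu> *\<^sub>R x}"
  shows "finite \<Lambda>" and "d * card \<Lambda> = DIM('a)"
    and "real d * (\<Sum>\<mu>\<in>\<Lambda>. \<mu> ^ j) = (\<Sum>e\<in>Basis. (f ^^ j) e \<bullet> e)"
proof -
  obtain B ev where B: "finite B" "span B = UNIV" "pairwise orthogonal B" "\<And>b. b \<in> B \<Longrightarrow> norm b = 1"
    and card: "card B = DIM('a)" and ev: "\<And>b. b \<in> B \<Longrightarrow> f b = ev b *\<^sub>R b"
    using selfadjoint_orthonormal_eigenbasis[OF f] by metis
  \<comment> \<open>Eigenvectors for different eigenvalues are orthogonal, so only basis vectors
    with \<open>ev b = \<mu>\<close> enter the expansion; the dimension of the eigenspace thus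
    counts the occurrences of \<open>\<mu>\<close>.\<close>
  have span: "{x. f x = \<mu> *\<^sub>R x} = span {b \<in> B. ev b = \<mu>}" for \<mu>
  proof
    show "span {b \<in> B. ev b = \<mu>} \<subseteq> {x. f x = \<mu> *\<^sub>R x}"
    proof (rule span_minimal)
      show "subspace {x. f x = \<mu> *\<^sub>R x}"
        by (auto simp: subspace_def linear_0[OF f(1)] linear_add[OF f(1)] linear_scale[OF f(1)] algebra_simps)
    qed (use ev in auto)
    show "{x. f x = \<mu> *\<^sub>R x} \<subseteq> span {b \<in> B. ev b = \<mu>}"
    proof
      fix x assume "x \<in> {x. f x = \<mu> *\<^sub>R x}"
      then have x: "f x = \<mu> *\<^sub>R x" by simp
      have "x \<bullet> b = 0" if "b \<in> B" "ev b \<noteq> \<mu>" for b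
        using f(2)[of x b] x ev[OF that(1)] that(2) by auto
      then have "(x \<bullet> b) *\<^sub>R b \<in> span {b \<in> B. ev b = \<mu>}" if "b \<in> B" for b
        using that by (cases "ev b = \<mu>") (auto intro: span_scale span_base span_0)
      then have "(\<Sum>b\<in>B. (x \<bullet> b) *\<^sub>R b) \<in> span {b \<in> B. ev b = \<mu>}" by (rule span_sum)
      then show "x \<in> span {b \<in> B. ev b = \<mu>}" by (simp only: orthonormal_basis_expand[OF B])
    qed
  qed
  have indep: "independent B" using B(3,4) by (intro pairwise_orthogonal_independent) force+
  have \<Lambda>: "\<Lambda> = ev ` B"
  proof
    show "ev ` B \<subseteq> \<Lambda>" 
    proof clarify
      fix b assume "b \<in> B"
      then show "ev b \<in> \<Lambda>" unfolding \<Lambda>_def using ev B(4)[of b] by (auto intro!: exI[of _ b])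
    qed
    show "\<Lambda> \<subseteq> ev ` B"
    proof
      fix \<mu> assume "\<mu> \<in> \<Lambda>"
      then obtain x where "x \<noteq> 0" "x \<in> span {b \<in> B. ev b = \<mu>}" unfolding \<Lambda>_def span[symmetric] by auto
      then have "{b \<in> B. ev b = \<mu>} \<noteq> {}" by (metis span_empty singletonD)
      then show "\<mu> \<in> ev ` B" by auto
    qed
  qed
  show fin: "finite \<Lambda>" unfolding \<Lambda> using B(1) by simp
  have mult: "card {b \<in> B. ev b = \<mu>} = d" if "\<mu> \<in> \<Lambda>" for \<mu>
  proof -
    have "dim {x. f x = \<mu> *\<^sub>R x} = d" using dim that unfolding \<Lambda>_def by blast
    moreover have "dim (span {b \<in> B. ev b = \<mu>}) = card {b \<in> B. ev b = \<mu>}"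
      using independent_mono[OF indep, of "{b \<in> B. ev b = \<mu>}"] by (auto simp: dim_eq_card_independent)
    ultimately show ?thesis unfolding span by simp
  qed
  have sum: "(\<Sum>b\<in>B. h (ev b)) = real d * (\<Sum>\<mu>\<in>\<Lambda>. h \<mu>)" for h :: "real \<Rightarrow> real"
  proof -
    have "(\<Sum>b\<in>B. h (ev b)) = (\<Sum>\<mu>\<in>\<Lambda>. \<Sum>b\<in>{b \<in> B. ev b = \<mu>}. h (ev b))"
      unfolding \<Lambda> using B(1) by (rule sum.image_gen)
    also have "\<dots> = (\<Sum>\<mu>\<in>\<Lambda>. real d * h \<mu>)"
      by (intro sum.cong refl) (simp add: mult)
    finally show ?thesis by (simp add: sum_distrib_left)
  qed
  have "real (card B) = real d * real (card \<Lambda>)" using sum[of "\<lambda>_. 1"] by simp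
  then show "d * card \<Lambda> = DIM('a)" unfolding card by (metis of_nat_eq_iff of_nat_mult)
  have lin: "linear (f ^^ j)" using f(1) by (rule linear_funpow)
  have "(f ^^ j) b = ev b ^ j *\<^sub>R b" if "b \<in> B" for b
    by (induction j) (auto simp: linear_scale[OF f(1)] ev[OF that])
  then have "(\<Sum>b\<in>B. (f ^^ j) b \<bullet> b) = (\<Sum>b\<in>B. ev b ^ j)"
    using B(4) by (intro sum.cong refl) (simp add: norm_eq_1)
  then show "real d * (\<Sum>\<mu>\<in>\<Lambda>. \<mu> ^ j) = (\<Sum>e\<in>Basis. (f ^^ j) e \<bullet> e)"
    using trace_orthonormal_basis[OF B lin] sum[of "\<lambda>\<mu>. \<mu> ^ j"] by simp
qed

section \<open>Flows of skew-symmetric maps\<close>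

text \<open>This is \<open>exp (t f)\<close> applied to \<open>x\<close>, written as a series of
  vectors so that no exponential of operators has to be introduced.\<close>

definition flow :: "('a \<Rightarrow> 'a) \<Rightarrow> real \<Rightarrow> 'a \<Rightarrow> 'a :: euclidean_space" where
  "flow f t x = (\<Sum>k. (t ^ k / fact k) *\<^sub>R (f ^^ k) x)"

lemma flow_sums:
  fixes f :: "'a :: euclidean_space \<Rightarrow> 'a"
  assumes "linear f"
  shows "(\<lambda>k. (t ^ k / fact k) *\<^sub>R (f ^^ k) x) sums flow f t x"
proof -
  obtain K where K: "\<And>x. norm (f x) \<le> K * norm x"
    using linear_bounded[OF assms] by blast
  define C where "C = max K 0"
  have C: "norm (f x) \<le> C * norm x" "C \<ge> 0" for x
    using K[of x] mult_right_mono[of K C "norm x"] by (auto simp: C_def)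
  have le: "norm ((f ^^ k) x) \<le> C ^ k * norm x" for k
  proof (induction k)
    case (Suc k)
    show ?case using C(1)[of "(f ^^ k) x"] mult_left_mono[OF Suc C(2)] by simp
  qed simp
  have "summable (\<lambda>k. (t ^ k / fact k) *\<^sub>R (f ^^ k) x)"
  proof (rule summable_comparison_test)
    have "summable (\<lambda>k. (\<bar>t\<bar> * C) ^ k /\<^sub>R fact k * norm x)"
      by (intro summable_mult2 summable_exp_generic)
    then show "summable (\<lambda>k. (\<bar>t\<bar> ^ k / fact k) * (C ^ k * norm x))"
      by (simp add: power_mult_distrib field_simps)
    show "\<exists>N. \<forall>n\<ge>N. norm ((t ^ n / fact n) *\<^sub>R (f ^^ n) x) \<le> (\<bar>t\<bar> ^ n / fact n) * (C ^ n * norm x)"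
      using le by (auto simp: power_abs intro!: exI[of _ 0] divide_right_mono mult_left_mono)
  qed
  then show ?thesis unfolding flow_def by (rule summable_sums)
qed

lemma flow_bounded_linear_sums:
  fixes f :: "'a :: euclidean_space \<Rightarrow> 'a"
  assumes "linear f" "bounded_linear g"
  shows "(\<lambda>k. (t ^ k / fact k) *\<^sub>R g ((f ^^ k) x)) sums g (flow f t x)"
  using bounded_linear.sums[OF assms(2) flow_sums[OF assms(1), of t x]]
  unfolding linear_scale[OF bounded_linear.linear[OF assms(2)]] .

lemma flow_commute:
  fixes f :: "'a :: euclidean_space \<Rightarrow> 'a"
  assumes "linear f"
  shows "flow f t (f x) = f (flow f t x)"
proof (rule sums_unique2)
  show "(\<lambda>k. (t ^ k / fact k) *\<^sub>R f ((f ^^ k) x)) sums f (flow f t x)"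
    by (rule flow_bounded_linear_sums[OF assms]) (use assms linear_conv_bounded_linear in blast)
  show "(\<lambda>k. (t ^ k / fact k) *\<^sub>R f ((f ^^ k) x)) sums flow f t (f x)"
    using flow_sums[OF assms, of t "f x"] by (simp add: funpow_swap1)
qed

lemma flow_commute_funpow:
  fixes f :: "'a :: euclidean_space \<Rightarrow> 'a"
  assumes "linear f"
  shows "flow f t ((f ^^ k) x) = (f ^^ k) (flow f t x)"
  by (induction k) (simp_all add: flow_commute[OF assms])

lemma flow_0 [simp]: "flow f 0 x = x"
proof -
  have "(\<lambda>k. (0 ^ k / fact k) *\<^sub>R (f ^^ k) x) = (\<lambda>k. if k = 0 then x else 0)" by auto
  then show ?thesis unfolding flow_def using sums_single[of 0 "\<lambda>_. x"] by (simp add: sums_iff)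
qed

text \<open>Each coordinate is an everywhere convergent real power series; differentiating termwise
  shifts its coefficients to those of the series for \<open>f x\<close>.\<close>

lemma flow_has_vector_derivative:
  fixes f :: "'a :: euclidean_space \<Rightarrow> 'a"
  assumes "linear f"
  shows "((\<lambda>t. flow f t x) has_vector_derivative f (flow f t x)) (at t)"
proof -
  have "((\<lambda>t. flow f t x \<bullet> b) has_real_derivative f (flow f t x) \<bullet> b) (at t)" for b
  proof -
    define c where "c k = ((f ^^ k) x \<bullet> b) / fact k" for k
    have sums: "(\<lambda>k. (s ^ k / fact k) * ((f ^^ k) y \<bullet> b)) sums (flow f s y \<bullet> b)" for s y
      using flow_bounded_linear_sums[OF assms bounded_linear_inner_left[of b], of s y] by simp
    have c: "(\<lambda>k. c k * s ^ k) sums (flow f s x \<bullet> b)" for s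
      using sums[of s x] unfolding c_def by (simp add: mult.commute)
    have d: "(\<lambda>k. diffs c k * t ^ k) sums (flow f t (f x) \<bullet> b)"
      using sums[of t "f x"] unfolding c_def diffs_def
      by (simp add: funpow_swap1 field_simps del: of_nat_Suc)
    have "((\<lambda>t. \<Sum>k. c k * t ^ k) has_real_derivative (\<Sum>k. diffs c k * t ^ k)) (at t)"
      by (rule termdiffs_strong_converges_everywhere) (use c in \<open>auto simp: sums_iff\<close>)
    then show ?thesis using c d by (simp add: sums_iff flow_commute[OF assms])
  qed
  then show ?thesis
    unfolding has_vector_derivative_def
    by (subst has_derivative_componentwise_within)
      (simp add: has_field_derivative_def mult.commute[of _ "f (flow f t x) \<bullet> _"])
qed

locale skew_map =
  fixes f :: "'a :: euclidean_space \<Rightarrow> 'a"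
  assumes lin: "linear f" and skew: "f x \<bullet> y = - (x \<bullet> f y)"
begin

text \<open>Skewness gives \<open>u \<bullet> f u = 0\<close>. The conserved norm yields uniqueness
  of solutions, from which linearity and the semigroup law of the flow follow without rearranging
  series.\<close>

lemma ode_norm_constant:
  assumes "\<And>t. (u has_vector_derivative f (u t)) (at t)"
  shows "u t \<bullet> u t = u 0 \<bullet> u 0"
proof -
  have "((\<lambda>t. u t \<bullet> u t) has_real_derivative 0) (at t)" for t
  proof -
    have "((\<lambda>t. u t \<bullet> u t) has_derivative (\<lambda>h. u t \<bullet> (h *\<^sub>R f (u t)) + (h *\<^sub>R f (u t)) \<bullet> u t)) (at t)"
      using assms[of t] unfolding has_vector_derivative_def by (rule bounded_bilinear.FDERIV[OF bounded_bilinear_inner]) (use assms[of t] in \<open>simp add: has_vector_derivative_def\<close>)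
    moreover have "(\<lambda>h. u t \<bullet> (h *\<^sub>R f (u t)) + (h *\<^sub>R f (u t)) \<bullet> u t) = (*) 0"
      using skew[of "u t" "u t"] by (simp add: fun_eq_iff inner_commute)
    ultimately show ?thesis unfolding has_field_derivative_def by (simp only:)
  qed
  then show ?thesis using DERIV_isconst_all[of "\<lambda>t. u t \<bullet> u t" t 0] by blast
qed

lemma ode_unique:
  assumes "\<And>t. (u has_vector_derivative f (u t)) (at t)"
    and "\<And>t. (v has_vector_derivative f (v t)) (at t)" and "u 0 = v 0"
  shows "u t = v t"
proof -
  have "((\<lambda>t. u t - v t) has_vector_derivative f (u t - v t)) (at t)" for t
    using has_vector_derivative_diff[OF assms(1)[of t] assms(2)[of t]] by (simp add: linear_diff[OF lin])
  from ode_norm_constant[OF this, of t] show ?thesis using assms(3) by simp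
qed

lemma flow_unique:
  assumes "\<And>t. (u has_vector_derivative f (u t)) (at t)"
  shows "u t = flow f t (u 0)"
  by (rule ode_unique[OF assms flow_has_vector_derivative[OF lin]]) simp

lemma linear_flow: "linear (flow f t)"
proof (rule linearI)
  show "flow f t (x + y) = flow f t x + flow f t y" for x y
  proof -
    have "((\<lambda>t. flow f t x + flow f t y) has_vector_derivative f (flow f t x + flow f t y)) (at t)" for t
      unfolding linear_add[OF lin]
      by (intro has_vector_derivative_add flow_has_vector_derivative[OF lin])
    from flow_unique[OF this] show ?thesis by simp
  qed
  show "flow f t (c *\<^sub>R x) = c *\<^sub>R flow f t x" for c x
  proof -
    have "((\<lambda>t. c *\<^sub>R flow f t x) has_vector_derivative f (c *\<^sub>R flow f t x)) (at t)" for t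
      unfolding linear_scale[OF lin]
      by (intro bounded_linear.has_vector_derivative[OF bounded_linear_scaleR_right]
          flow_has_vector_derivative[OF lin])
    from flow_unique[OF this] show ?thesis by simp
  qed
qed

lemma flow_inner: "flow f t x \<bullet> flow f t y = x \<bullet> y"
proof -
  have *: "flow f t x \<bullet> flow f t x = x \<bullet> x" for x
    using ode_norm_constant[OF flow_has_vector_derivative[OF lin, of x], of t] by simp
  show ?thesis
    using *[of "x + y"] *[of x] *[of y]
    by (simp add: linear_add[OF linear_flow] inner_add_left inner_add_right inner_commute)
qed

lemma norm_flow: "norm (flow f t x) = norm x"
  by (simp add: norm_eq_sqrt_inner flow_inner)

lemma flow_add: "flow f (s + t) x = flow f t (flow f s x)"
proof -
  have "((\<lambda>t. flow f (s + t) x) has_vector_derivative f (flow f (s + t) x)) (at t)" for t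
  proof -
    have "((\<lambda>t. s + t) has_vector_derivative 1) (at t)"
      by (auto intro!: derivative_eq_intros)
    from vector_diff_chain_at[OF this flow_has_vector_derivative[OF lin, of x "s + t"]]
    show ?thesis by (simp add: o_def)
  qed
  from flow_unique[OF this, of t] show ?thesis by simp
qed

lemma flow_mult_nat: "flow f (real m * t) x = (flow f t ^^ m) x"
  by (induction m arbitrary: x) (simp_all add: distrib_right flow_add funpow_swap1)

end

section \<open>Small symmetric integral spectra\<close>

text \<open>The squarefree part records the parities of the prime multiplicities, and these agree
  for \<open>a\<close> and \<open>b\<close> when the product is a square.\<close>

lemma squarefree_part_eq_if_mult_square:
  fixes a b c :: nat
  assumes "a * b = c ^ 2" "a > 0" "b > 0"
  shows "squarefree_part a = squarefree_part b"
proof (rule multiplicity_eq_nat)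
  fix p :: nat assume p: "prime p"
  have "multiplicity p a + multiplicity p b = 2 * multiplicity p c"
  proof -
    have "multiplicity p (a * b) = multiplicity p a + multiplicity p b"
      using p assms by (intro prime_elem_multiplicity_mult_distrib) auto
    moreover have "c \<noteq> 0" using assms by (intro notI) simp
    then have "multiplicity p (c ^ 2) = 2 * multiplicity p c"
      using p assms by (intro prime_elem_multiplicity_power_distrib) auto
    ultimately show ?thesis using assms(1) by simp
  qed
  then have "multiplicity p a mod 2 = multiplicity p b mod 2" by presburger
  then show "multiplicity p (squarefree_part a) = multiplicity p (squarefree_part b)"
    using p assms by (simp add: prime_multiplicity_squarefree_part)
qed (auto intro!: gr0I)

text \<open>The extremal set is \<open>{1..card M}\<close>. Removing the maximum, which is at least
  the cardinality, gives the induction.\<close>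

lemma sum_squares_ge:
  fixes M :: "nat set"
  assumes "finite M" "0 \<notin> M"
  shows "card M * (card M + 1) * (2 * card M + 1) \<le> 6 * (\<Sum>m\<in>M. m ^ 2)"
  using assms
proof (induction M rule: finite_linorder_max_induct)
  case (insert b A)
  have "insert b A \<subseteq> {1..b}" using insert by (auto simp: Suc_le_eq less_imp_le intro: gr0I)
  then have "card (insert b A) \<le> b" using card_mono[of "{1..b}"] by fastforce
  moreover have "b \<notin> A" using insert by auto
  ultimately have b: "Suc (card A) \<le> b" using insert by simp
  have "(card A + 1) * (card A + 2) * (2 * card A + 3)
      = card A * (card A + 1) * (2 * card A + 1) + 6 * (Suc (card A)) ^ 2"
    by (simp add: power2_eq_square algebra_simps)
  also have "\<dots> \<le> 6 * (\<Sum>m\<in>A. m ^ 2) + 6 * b ^ 2"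
    using insert b by (intro add_mono mult_left_mono power_mono) auto
  finally show ?case using insert \<open>b \<notin> A\<close> by (simp add: algebra_simps)
qed simp

text \<open>The nonzero eigenvalues are plus and minus \<open>x * sqrt d\<close> for
  \<open>x\<close> in \<open>xs\<close>; \<open>k\<close> is a vertex degree, and the trace of the
  square determines \<open>d\<close>. The tenth powers are there for \<open>n = 11\<close> and
  \<open>xs = [1,2,3,4,5]\<close>: then \<open>d = 1\<close> and \<open>k = 10\<close> fit the trace
  exactly, and -5, ..., 5 run through all residues modulo 11, so that 10 is the first positive
  exponent whose power sum is not divisible by 11.\<close>

lemma small_spectra_check:
  "\<forall>xs\<in>set (subseqs [1,2,3,4,5::int]). xs \<noteq> [] \<longrightarrow>
     (let s2 = 2 * sum_list (map (\<lambda>x. x ^ 2) xs); s4 = 2 * sum_list (map (\<lambda>x. x ^ 4) xs);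
      s6 = 2 * sum_list (map (\<lambda>x. x ^ 6) xs); s10 = 2 * sum_list (map (\<lambda>x. x ^ 10) xs); p = int (length xs) in
    (\<forall>n\<in>set [2 * p, 2 * p + 1]. \<forall>k\<in>set [0..n-1]. 
       s2 \<le> n * k \<longrightarrow> (n * k) mod s2 = 0 \<longrightarrow>
     (let d = (n * k) div s2 in (d ^ 2 * s4) mod n = 0 \<longrightarrow> (d ^ 3 * s6) mod n = 0 \<longrightarrow>
        (d ^ 5 * s10) mod n = 0 \<longrightarrow> n \<le> 3 \<and> k = n - 1)))"
  by code_simp

text \<open>The trace bound \<open>n * k \<le> n * (n - 1)\<close> confines \<open>M\<close> to
  \<open>{1..5}\<close>, after which the finite check applies.\<close>

lemma small_spectra:
  fixes M :: "nat set" and d n k :: nat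
  assumes M: "finite M" "0 \<notin> M" and n: "n = 2 * card M \<or> n = 2 * card M + 1" "n \<ge> 2"
    and d: "d \<ge> 1" and k: "k < n" and sum2: "2 * d * (\<Sum>m\<in>M. m ^ 2) = n * k"
    and dvd: "\<And>j. j \<ge> 1 \<Longrightarrow> n dvd 2 * d ^ j * (\<Sum>m\<in>M. m ^ (2 * j))"
  shows "n \<le> 3 \<and> k = n - 1"
proof -
  define p where "p = card M"
  have p: "p \<ge> 1" using n unfolding p_def by linarith
  have "2 * (\<Sum>m\<in>M. m ^ 2) \<le> n * k" using d by (simp flip: sum2)
  also have "\<dots> \<le> n * (n - 1)" using k by (intro mult_left_mono) auto
  finally have S: "2 * (\<Sum>m\<in>M. m ^ 2) \<le> n * (n - 1)" .
  \<comment> \<open>A member of at least 6 contributes 216, which is 6 times 36, to 6 times the sum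
    of squares, and the other \<open>t\<close> members contribute at least
    \<open>t * (t + 1) * (2 * t + 1)\<close>. This always exceeds the trace bound. For 5 in place of
    6 and \<open>t = 4\<close> there would be equality, so this comparison gives no smaller
    limit.\<close>
  have le: "m \<le> 5" if m: "m \<in> M" for m
  proof (rule ccontr)
    assume "\<not> m \<le> 5"
    then have "6 ^ 2 \<le> m ^ 2" by (intro power_mono) auto
    moreover obtain t where t: "card M = Suc t" using p unfolding p_def by (cases "card M") auto
    moreover have "card (M - {m}) = t" using M m t by simp
    then have "t * (t + 1) * (2 * t + 1) \<le> 6 * (\<Sum>m\<in>M - {m}. m ^ 2)"
      using sum_squares_ge[of "M - {m}"] M by simp
    moreover have "(\<Sum>m\<in>M. m ^ 2) = m ^ 2 + (\<Sum>m\<in>M - {m}. m ^ 2)" using M m by (intro sum.remove) auto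
    ultimately have "216 + t * (t + 1) * (2 * t + 1) \<le> 3 * (2 * (\<Sum>m\<in>M. m ^ 2))" by simp
    also have "\<dots> \<le> 3 * ((2 * t + 3) * (2 * t + 2))"
    proof -
      have "n \<le> 2 * t + 3" "n - 1 \<le> 2 * t + 2" using n t by auto
      then have "n * (n - 1) \<le> (2 * t + 3) * (2 * t + 2)" by (rule mult_mono) auto
      then show ?thesis using S by linarith
    qed
    finally have *: "216 + t * (t + 1) * (2 * t + 1) \<le> 3 * ((2 * t + 3) * (2 * t + 2))" .
    then have **: "int (216 + t * (t + 1) * (2 * t + 1)) \<le> int (3 * ((2 * t + 3) * (2 * t + 2)))" by linarith
    have "t < 8"
    proof (rule ccontr)
      assume "\<not> t < 8"
      then have t: "8 \<le> int t" by simp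
      \<comment> \<open>Names for the first three powers of \<open>t\<close> make the comparison of
        cubic and quadratic terms linear.\<close>
      define T u w where "T = int t" and "u = T * T" and "w = T * u"
      have "216 + (2 * w + 3 * u + T) \<le> 3 * (4 * u + 10 * T + 6)"
        using ** unfolding u_def w_def T_def by (simp add: algebra_simps)
      moreover have "8 * u \<le> w" "8 * T \<le> u"
        unfolding u_def w_def T_def using t by (intro mult_right_mono; simp)+
      moreover have "8 \<le> T" using t unfolding T_def .
      ultimately show False by simp
    qed
    then consider "t = 0" | "t = 1" | "t = 2" | "t = 3" | "t = 4" | "t = 5" | "t = 6" | "t = 7" by linarith
    then show False using ** by cases auto
  qed
  define L where "L = [1,2,3,4,5::int]"
  have "int ` M \<subseteq> set L"
  proof clarify
    fix m assume m: "m \<in> M"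
    then have "m \<in> {1,2,3,4,5}" using le[OF m] M(2) by (cases "m = 0") auto
    then show "int m \<in> set L" unfolding L_def by auto
  qed
  then have "int ` M \<in> set ` set (subseqs L)" by (rule subset_subseqs)
  then obtain xs where xs: "xs \<in> set (subseqs L)" "set xs = int ` M" by auto
  have dist: "distinct xs" using subseqs_distinctD[OF xs(1)] by (simp add: L_def)
  have len: "length xs = p" using distinct_card[OF dist] xs(2) by (simp add: card_image p_def)
  have sl: "sum_list (map (\<lambda>x. x ^ j) xs) = int (\<Sum>m\<in>M. m ^ j)" for j
    using dist xs(2) by (simp add: sum_list_distinct_conv_sum_set sum.reindex)
  define s where "s j = 2 * sum_list (map (\<lambda>x. x ^ j) xs)" for j
  have s2: "int d * s 2 = int n * int k"
    using arg_cong[OF sum2, of int] unfolding s_def sl by simp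
  have "k > 0"
  proof -
    have "card M \<noteq> 0" using p unfolding p_def by simp
    then obtain m where "m \<in> M" by fastforce
    then have "m ^ 2 \<le> (\<Sum>m\<in>M. m ^ 2)" "m \<noteq> 0"
      using M by (auto intro: member_le_sum intro!: gr0I)
    then have "(\<Sum>m\<in>M. m ^ 2) > 0" by (metis gr0I le_zero_eq power_not_zero)
    then have "n * k > 0" using d by (simp flip: sum2)
    then show ?thesis by simp
  qed
  have s2pos: "s 2 > 0"
  proof (rule ccontr)
    assume "\<not> s 2 > 0"
    then have "int d * s 2 \<le> 0" by (simp add: mult_nonneg_nonpos)
    moreover have "int n * int k > 0" using \<open>k > 0\<close> n by simp
    ultimately show False using s2 by simp
  qed
  then have s2le: "s 2 \<le> int n * int k"
    using d mult_right_mono[of 1 "int d" "s 2"] by (simp flip: s2)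
  have dd: "int n * int k div s 2 = int d" "int n * int k mod s 2 = 0"
    using s2pos by (simp_all flip: s2)
  have dvd': "int d ^ j * s (2 * j) mod int n = 0" if "j \<ge> 1" for j
  proof -
    have "int n dvd int (2 * d ^ j * (\<Sum>m\<in>M. m ^ (2 * j)))" using dvd[OF that] by (simp only: int_dvd_int_iff)
    also have "int (2 * d ^ j * (\<Sum>m\<in>M. m ^ (2 * j))) = int d ^ j * s (2 * j)"
      unfolding s_def sl by (simp only: of_nat_mult of_nat_power of_nat_numeral mult_ac)
    finally show ?thesis by simp
  qed
  have *: "\<forall>n\<in>set [2 * int (length xs), 2 * int (length xs) + 1]. \<forall>k\<in>set [0..n-1].
       s 2 \<le> n * k \<longrightarrow> (n * k) mod s 2 = 0 \<longrightarrow>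
     (let d = (n * k) div s 2 in (d ^ 2 * s 4) mod n = 0 \<longrightarrow> (d ^ 3 * s 6) mod n = 0 \<longrightarrow>
        (d ^ 5 * s 10) mod n = 0 \<longrightarrow> n \<le> 3 \<and> k = n - 1)"
    using bspec[OF small_spectra_check[folded L_def] xs(1)] len p unfolding s_def Let_def by auto
  have n_mem: "int n \<in> set [2 * int (length xs), 2 * int (length xs) + 1]" using n len unfolding p_def by auto
  have k_mem: "int k \<in> set [0..int n - 1]" using k by auto
  have "int n \<le> 3 \<and> int k = int n - 1"
    using bspec[OF bspec[OF * n_mem] k_mem] s2le dd dvd'[of 2] dvd'[of 3] dvd'[of 5]
    unfolding Let_def by simp
  then show ?thesis by linarith
qed

text \<open>Integrality of mixed products, beyond that of squares, gives all positive elements a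
  common squarefree part \<open>d\<close>; they are therefore integer multiples of
  \<open>sqrt d\<close>, which is the situation of \<open>small_spectra\<close>.\<close>

lemma integral_symmetric_spectrum:
  fixes \<Lambda> :: "real set" and n k :: nat
  assumes \<Lambda>: "finite \<Lambda>" "card \<Lambda> = n" "n \<ge> 2" "\<And>\<theta>. \<theta> \<in> \<Lambda> \<Longrightarrow> - \<theta> \<in> \<Lambda>"
    and prods: "\<And>\<theta> \<mu>. \<theta> \<in> \<Lambda> \<Longrightarrow> \<mu> \<in> \<Lambda> \<Longrightarrow> \<theta> * \<mu> \<in> \<int>"
    and sum2: "(\<Sum>\<theta>\<in>\<Lambda>. \<theta> ^ 2) = real n * real k" and k: "k < n"
    and sums: "\<And>j. \<exists>c::int. (\<Sum>\<theta>\<in>\<Lambda>. \<theta> ^ (2 * j)) = real n * of_int c"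
  shows "n \<le> 3 \<and> k = n - 1"
proof -
  define P where "P = {\<theta> \<in> \<Lambda>. \<theta> > 0}"
  have P: "finite P" unfolding P_def using \<Lambda>(1) by simp
  have split: "\<Lambda> = (P \<union> uminus ` P) \<union> (\<Lambda> \<inter> {0})"
  proof (intro Set.set_eqI iffI)
    fix \<theta> assume "\<theta> \<in> \<Lambda>"
    then show "\<theta> \<in> (P \<union> uminus ` P) \<union> (\<Lambda> \<inter> {0})"
      using \<Lambda>(4)[of \<theta>] image_eqI[of \<theta> uminus "- \<theta>" P] by (cases \<theta> "0::real" rule: linorder_cases) (auto simp: P_def)
  qed (auto simp: P_def \<Lambda>(4))
  have disj: "P \<inter> uminus ` P = {}" "(P \<union> uminus ` P) \<inter> (\<Lambda> \<inter> {0}) = {}" unfolding P_def by auto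
  have sumP: "(\<Sum>\<theta>\<in>\<Lambda>. g \<theta>) = 2 * (\<Sum>\<theta>\<in>P. g \<theta>) + (\<Sum>\<theta>\<in>\<Lambda> \<inter> {0}. g \<theta>)"
    if "\<And>\<theta>. g (- \<theta>) = g \<theta>" for g :: "real \<Rightarrow> real"
  proof -
    have "(\<Sum>\<theta>\<in>\<Lambda>. g \<theta>) = (\<Sum>\<theta>\<in>P \<union> uminus ` P. g \<theta>) + (\<Sum>\<theta>\<in>\<Lambda> \<inter> {0}. g \<theta>)"
      by (subst split, rule sum.union_disjoint) (use P disj in auto)
    also have "(\<Sum>\<theta>\<in>P \<union> uminus ` P. g \<theta>) = (\<Sum>\<theta>\<in>P. g \<theta>) + (\<Sum>\<theta>\<in>P. g \<theta>)"
      using P disj that by (subst sum.union_disjoint) (auto simp: sum.reindex)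
    finally show ?thesis by simp
  qed
  \<comment> \<open>The condition on \<open>j\<close> excludes exponent 0, for which a zero
    eigenvalue would contribute 1.\<close>
  have sumP2: "(\<Sum>\<theta>\<in>\<Lambda>. \<theta> ^ (2 * j)) = 2 * (\<Sum>\<theta>\<in>P. \<theta> ^ (2 * j))" if "j \<ge> 1" for j
    using sumP[of "\<lambda>\<theta>. \<theta> ^ (2 * j)"] that by (simp add: sum.neutral)
  have "card (\<Lambda> \<inter> {0}) \<le> 1" using card_mono[of "{0::real}" "\<Lambda> \<inter> {0}"] by simp
  moreover have "real (card \<Lambda>) = 2 * real (card P) + real (card (\<Lambda> \<inter> {0}))" using sumP[of "\<lambda>_. 1"] by simp
  ultimately have cardP: "n = 2 * card P \<or> n = 2 * card P + 1" using \<Lambda>(2) by linarith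
  have sq: "\<exists>a::nat. a > 0 \<and> \<theta> ^ 2 = real a" if "\<theta> \<in> P" for \<theta>
  proof -
    have "\<theta> * \<theta> \<in> \<int>" using prods that unfolding P_def by blast
    then obtain a where "\<theta> * \<theta> = of_int a" by (auto elim: Ints_cases)
    moreover have "\<theta> * \<theta> > 0" using that unfolding P_def by simp
    ultimately show ?thesis by (intro exI[of _ "nat a"]) (auto simp: power2_eq_square)
  qed
  have "card P \<noteq> 0" using cardP \<Lambda>(3) by auto
  then obtain \<theta>0 where \<theta>0: "\<theta>0 \<in> P" by fastforce
  obtain a0 :: nat where a0: "a0 > 0" "\<theta>0 ^ 2 = real a0" using sq[OF \<theta>0] by blast
  \<comment> \<open>One reference element fixes \<open>d\<close>: for any other
    \<open>\<theta>\<close> the product of the integers \<open>\<theta> ^ 2\<close> and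
    \<open>\<theta>0 ^ 2\<close> is the square of the integer \<open>\<theta> * \<theta>0\<close>,
    so their squarefree parts agree.\<close>
  define d where "d = squarefree_part a0"
  have d: "d \<ge> 1" using squarefree_part_nonzero[of a0] unfolding d_def by linarith
  define M where "M = {m. real m * sqrt d \<in> P}"
  have inj: "inj_on (\<lambda>m. real m * sqrt d) M" using d by (auto simp: inj_on_def)
  have PM: "P = (\<lambda>m. real m * sqrt d) ` M"
  proof
    show "P \<subseteq> (\<lambda>m. real m * sqrt d) ` M"
    proof
      fix \<theta> assume \<theta>: "\<theta> \<in> P"
      obtain a :: nat where a: "a > 0" "\<theta> ^ 2 = real a" using sq[OF \<theta>] by blast
      have "\<theta> * \<theta>0 \<in> \<int>" using prods \<theta> \<theta>0 unfolding P_def by blast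
      then obtain c where c: "\<theta> * \<theta>0 = of_int c" by (auto elim: Ints_cases)
      have "real (a * a0) = of_int c ^ 2" unfolding c[symmetric] power_mult_distrib a a0 by simp
      then have "int (a * a0) = c ^ 2"
        by (metis of_int_eq_iff of_int_of_nat_eq of_int_power)
      then have "int (a * a0) = int (nat \<bar>c\<bar> ^ 2)" by simp
      then have "a * a0 = nat \<bar>c\<bar> ^ 2" by (simp only: of_nat_eq_iff)
      then have "squarefree_part a = d"
        using squarefree_part_eq_if_mult_square a a0 unfolding d_def by blast
      then have "a = d * square_part a ^ 2" using squarefree_decompose[of a] by simp
      then have "real a = real d * real (square_part a) ^ 2" by (metis of_nat_mult of_nat_power)
      then have "\<theta> ^ 2 = (real (square_part a) * sqrt d) ^ 2"
        using a(2) by (simp add: power_mult_distrib)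
      then have "\<theta> = real (square_part a) * sqrt d"
        using \<theta> unfolding P_def by (intro power2_eq_imp_eq[of \<theta>]) auto
      then show "\<theta> \<in> (\<lambda>m. real m * sqrt d) ` M" using \<theta> unfolding M_def by auto
    qed
  qed (auto simp: M_def)
  have finM: "finite M" using P inj unfolding PM by (simp add: finite_image_iff)
  have "0 \<notin> M" unfolding M_def P_def by auto
  have cardM: "card M = card P" unfolding PM using inj by (simp add: card_image)
  have sumM: "(\<Sum>\<theta>\<in>\<Lambda>. \<theta> ^ (2 * j)) = real (2 * d ^ j * (\<Sum>m\<in>M. m ^ (2 * j)))" if "j \<ge> 1" for j
  proof -
    have "(\<Sum>\<theta>\<in>P. \<theta> ^ (2 * j)) = (\<Sum>m\<in>M. (real m * sqrt d) ^ (2 * j))"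
      unfolding PM using inj by (simp add: sum.reindex)
    also have "\<dots> = real (d ^ j * (\<Sum>m\<in>M. m ^ (2 * j)))"
    proof -
      have "(real m * sqrt d) ^ (2 * j) = real d ^ j * real m ^ (2 * j)" for m
        unfolding power_mult power_mult_distrib by simp
      then show ?thesis by (simp add: sum_distrib_left)
    qed
    finally show ?thesis unfolding sumP2[OF that] by simp
  qed
  show ?thesis
  proof (rule small_spectra[OF finM \<open>0 \<notin> M\<close> _ \<Lambda>(3) d k])
    show "n = 2 * card M \<or> n = 2 * card M + 1" using cardP cardM by simp
    have "real (2 * d * (\<Sum>m\<in>M. m ^ 2)) = real (n * k)"
      using sumM[of 1] sum2 by simp
    then show "2 * d * (\<Sum>m\<in>M. m ^ 2) = n * k" by (simp only: of_nat_eq_iff)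
    show "n dvd 2 * d ^ j * (\<Sum>m\<in>M. m ^ (2 * j))" if "j \<ge> 1" for j
    proof -
      obtain c where "real (2 * d ^ j * (\<Sum>m\<in>M. m ^ (2 * j))) = real n * of_int c"
        using sums[of j] sumM[OF \<open>1 \<le> j\<close>] by auto
      then have "int (2 * d ^ j * (\<Sum>m\<in>M. m ^ (2 * j))) = int n * c"
        by (metis of_int_eq_iff of_int_mult of_int_of_nat_eq)
      then show ?thesis by (metis dvd_triv_left int_dvd_int_iff)
    qed
  qed
qed

section \<open>Skew-symmetric matrices with transitive flow\<close>

text \<open>An eigenvalue is a root of the characteristic polynomial, which is monic with integer
  coefficients. The bijection \<open>g\<close> carries the index type to \<open>{0..<n}\<close>,
  where matrices with explicit dimensions live.\<close>

lemma algebraic_int_eigenvalue: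
  fixes A :: "'n::finite \<Rightarrow> 'n \<Rightarrow> int" and x :: "'n \<Rightarrow> complex"
  assumes eig: "\<And>i. (\<Sum>j\<in>UNIV. of_int (A i j) * x j) = \<mu> * x i" and nz: "x i0 \<noteq> 0"
  shows "algebraic_int \<mu>"
proof -
  define n where "n = CARD('n)"
  obtain g :: "nat \<Rightarrow> 'n" where g: "bij_betw g {0..<n} UNIV"
    using ex_bij_betw_nat_finite[of "UNIV :: 'n set"] unfolding n_def by auto
  define B where "B = Matrix.mat n n (\<lambda>(i, j). A (g i) (g j))"
  define v where "v = Matrix.vec n (\<lambda>i. x (g i))"
  have B: "B \<in> carrier_mat n n" and v: "v \<in> carrier_vec n" unfolding B_def v_def by auto
  let ?C = "map_mat of_int B :: complex mat"
  have C: "?C \<in> carrier_mat n n" using B by simp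
  have "v \<noteq> 0\<^sub>v n"
  proof -
    obtain k where "k < n" "g k = i0" using g by (auto simp: bij_betw_def image_iff) (metis UNIV_I atLeastLessThan_iff imageE)
    then have "vec_index v k \<noteq> vec_index (0\<^sub>v n) k" unfolding v_def using nz by simp
    then show ?thesis by auto
  qed
  moreover have "?C *\<^sub>v v = \<mu> \<cdot>\<^sub>v v"
  proof (rule eq_vecI)
    fix i assume "i < dim_vec (\<mu> \<cdot>\<^sub>v v)"
    then have i: "i < n" using v by simp
    have "vec_index (?C *\<^sub>v v) i = (\<Sum>j = 0..<n. of_int (A (g i) (g j)) * x (g j))"
      using i unfolding B_def v_def by (simp add: scalar_prod_def)
    also have "\<dots> = (\<Sum>j\<in>UNIV. of_int (A (g i) j) * x j)"
      by (rule sum.reindex_bij_betw[OF g])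
    finally show "vec_index (?C *\<^sub>v v) i = vec_index (\<mu> \<cdot>\<^sub>v v) i"
      using i unfolding eig v_def by simp
  qed (use B v in auto)
  ultimately have "eigenvalue ?C \<mu>"
    unfolding eigenvalue_def eigenvector_def using v B by auto
  then have "poly (char_poly ?C) \<mu> = 0" using eigenvalue_root_char_poly[OF C] by simp
  moreover have "char_poly ?C = map_poly of_int (char_poly B)" using of_int_hom.char_poly_hom[OF B] .
  moreover have "lead_coeff (char_poly ?C) = 1" using degree_monic_char_poly[OF C] by simp
  ultimately show ?thesis
    by (intro algebraic_int.intros[of "char_poly ?C"]) (auto simp: coeff_map_poly)
qed

lemma sum_scaleR_axis:
  fixes x :: "real ^ 'n"
  shows "(\<Sum>i\<in>UNIV. x $ i *\<^sub>R axis i 1) = x"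
  using basis_expansion[of x] by (simp add: scalar_mult_eq_scaleR)

lemma det_Ints:
  fixes A :: "real ^ 'n ^ 'n"
  assumes "\<And>i j. A $ i $ j \<in> \<int>"
  shows "Determinants.det A \<in> \<int>"
  unfolding Determinants.det_def using assms by (intro Ints_sum Ints_mult Ints_prod Ints_of_int) auto

locale transitive_flow =
  fixes S :: "real ^ 'n ^ 'n"
  assumes skew_entries: "S $ i $ j = - S $ j $ i"
    and int_entries: "S $ i $ j \<in> \<int>"
    and transitive: "a \<noteq> b \<Longrightarrow> \<exists>t \<epsilon>. \<bar>\<epsilon>\<bar> = 1 \<and> flow ((*v) S) t (axis a 1) = \<epsilon> *\<^sub>R axis b 1"
begin

abbreviation f where "f \<equiv> (*v) S"

sublocale skew_map f
proof (rule skew_map.intro)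
  show "linear f" by simp
  show "f x \<bullet> y = - (x \<bullet> f y)" for x y
  proof -
    have "f x \<bullet> y = (\<Sum>i\<in>UNIV. \<Sum>j\<in>UNIV. S $ i $ j * x $ j * y $ i)"
      by (simp add: inner_vec_def matrix_vector_mult_def sum_distrib_right)
    also have "\<dots> = (\<Sum>j\<in>UNIV. \<Sum>i\<in>UNIV. - (x $ j * (S $ j $ i * y $ i)))"
      by (subst sum.swap, intro sum.cong refl, subst skew_entries) simp
    also have "\<dots> = - (x \<bullet> f y)"
      by (simp add: inner_vec_def matrix_vector_mult_def sum_distrib_left sum_negf)
    finally show ?thesis .
  qed
qed

lemma transitive': "\<exists>t \<epsilon>. \<bar>\<epsilon>\<bar> = 1 \<and> flow f t (axis a 1) = \<epsilon> *\<^sub>R axis b 1"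
proof (cases "a = b")
  case True
  then show ?thesis by (intro exI[of _ 0] exI[of _ 1]) simp
qed (rule transitive)

text \<open>The orbit of \<open>axis a 1\<close> is a limit of combinations of its Krylov vectors,
  and up to sign it passes through every coordinate vector.\<close>

lemma cyclic:
  assumes "\<And>k. x \<bullet> (f ^^ k) (axis a 1) = 0"
  shows "x = 0"
proof -
  have "x $ b = 0" for b
  proof -
    obtain t \<epsilon> where t: "\<bar>\<epsilon>\<bar> = 1" "flow f t (axis a 1) = \<epsilon> *\<^sub>R axis b 1" using transitive' by blast
    have "(\<lambda>k. 0) sums (x \<bullet> flow f t (axis a 1))"
      using flow_bounded_linear_sums[OF lin bounded_linear_inner_right[of x], of t "axis a 1"] assms by simp
    then have "x \<bullet> flow f t (axis a 1) = 0" using sums_0 sums_unique2 by blast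
    then show ?thesis using t by (auto simp: inner_axis)
  qed
  then show ?thesis by (simp add: vec_eq_iff)
qed

text \<open>The flow is orthogonal and commutes with \<open>f\<close>, so it carries one diagonal
  entry to another; the sign enters squared.\<close>

lemma diagonal_constant: "(f ^^ k) (axis a 1) $ a = (f ^^ k) (axis b 1) $ b"
proof -
  obtain t \<epsilon> where t: "\<bar>\<epsilon>\<bar> = 1" "flow f t (axis a 1) = \<epsilon> *\<^sub>R axis b 1" using transitive' by blast
  have "(f ^^ k) (axis a 1) $ a = (f ^^ k) (axis a 1) \<bullet> axis a 1" by (simp add: inner_axis)
  also have "\<dots> = (f ^^ k) (flow f t (axis a 1)) \<bullet> flow f t (axis a 1)"
    by (simp add: flow_inner flip: flow_commute_funpow[OF lin])
  also have "\<dots> = \<epsilon> * \<epsilon> * (f ^^ k) (axis b 1) $ b"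
    by (simp add: t(2) linear_scale[OF linear_funpow[OF lin]] inner_axis)
  also have "\<epsilon> * \<epsilon> = 1" using t(1) by (metis abs_mult_self_eq mult_1)
  finally show ?thesis by simp
qed

lemma int_vec_f: "int_vec x \<Longrightarrow> int_vec (f x)"
  unfolding int_vec_def matrix_vector_mult_def using int_entries by (auto intro!: Ints_sum Ints_mult)

lemma int_vec_funpow: "int_vec x \<Longrightarrow> int_vec ((f ^^ k) x)"
  by (induction k) (auto intro: int_vec_f)

lemma int_vec_axis: "int_vec (axis a 1)"
  by (simp add: int_vec_def axis_def)

text \<open>Every column of \<open>flow f t\<close> solves a linear system whose matrix is a basis of Krylov
  vectors, so Cramer's rule gives it the Krylov determinant as a denominator.\<close>

lemma flow_rational:
  assumes "\<bar>\<epsilon>\<bar> = 1" "flow f t (axis a 1) = \<epsilon> *\<^sub>R axis b 1"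
  shows "\<exists>D::nat. D \<ge> 1 \<and> (\<forall>x. int_vec x \<longrightarrow> int_vec (real D *\<^sub>R flow f t x))"
proof -
  define Kr where "Kr = range (\<lambda>k. (f ^^ k) (axis a 1 :: real ^ 'n))"
  have "dim Kr = DIM(real ^ 'n)"
  proof (rule ccontr)
    assume "dim Kr \<noteq> DIM(real ^ 'n)"
    then have "dim Kr < DIM(real ^ 'n)" using dim_subset_UNIV[of Kr] by linarith
    then obtain x where x: "x \<noteq> 0" "\<And>y. y \<in> span Kr \<Longrightarrow> orthogonal x y"
      using orthogonal_to_subspace_exists[of Kr] by blast
    then have "x \<bullet> (f ^^ k) (axis a 1) = 0" for k
      using span_base[of _ Kr] unfolding orthogonal_def Kr_def by blast
    then show False using cyclic x(1) by blast
  qed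
  moreover obtain B where B: "B \<subseteq> Kr" "independent B" "Kr \<subseteq> span B" "card B = dim Kr"
    using basis_exists[of Kr] by metis
  ultimately have "card B = card (UNIV :: 'n set)" by simp
  then obtain g where g: "bij_betw g (UNIV :: 'n set) B"
    using finite_same_card_bij[of "UNIV :: 'n set" B] independent_imp_finite[OF B(2)] by auto
  have gKr: "\<exists>k. g j = (f ^^ k) (axis a 1)" for j
    using g B(1) unfolding Kr_def bij_betw_def by blast
  define W where "W = (\<chi> j i. g j $ i)"
  have W: "(W *v y) $ j = g j \<bullet> y" for y j
    unfolding W_def by (simp add: matrix_vector_mult_def inner_vec_def)
  have "inj ((*v) W)"
  proof (subst linear_injective_0)
    show "\<forall>y. W *v y = 0 \<longrightarrow> y = 0"
    proof (intro allI impI)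
      fix y assume y: "W *v y = 0"
      have "y \<bullet> v = 0" if "v \<in> B" for v
        using W[of y "inv_into UNIV g v"] y g that unfolding bij_betw_def
        by (simp add: f_inv_into_f inner_commute)
      then have "orthogonal y v" if "v \<in> span B" for v
        using that orthogonal_to_span[of v B y] by (auto simp: orthogonal_def)
      then have "y \<bullet> (f ^^ k) (axis a 1) = 0" for k
        using B(3) unfolding Kr_def orthogonal_def by blast
      then show "y = 0" by (rule cyclic)
    qed
  qed simp
  then have det0: "Determinants.det W \<noteq> 0"
    using det_nz_iff_inj[of "(*v) W"] by simp
  have Wint: "W $ i $ j \<in> \<int>" for i j
    unfolding W_def using gKr[of i] int_vec_funpow[OF int_vec_axis] by (auto simp: int_vec_def)
  define row where "row i = (\<chi> l. flow f t (axis l 1) $ i)" for i :: 'n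
  have row: "flow f t x $ i = row i \<bullet> x" for x i
  proof -
    have "flow f t x = flow f t (\<Sum>l\<in>UNIV. x $ l *\<^sub>R axis l 1)" by (simp add: sum_scaleR_axis)
    also have "\<dots> = (\<Sum>l\<in>UNIV. x $ l *\<^sub>R flow f t (axis l 1))"
      by (simp add: linear_sum[OF linear_flow] linear_scale[OF linear_flow])
    finally show ?thesis by (simp add: row_def inner_vec_def mult.commute)
  qed
  have "\<epsilon> \<in> \<int>" using assms(1) by (auto simp: abs_if split: if_splits)
  \<comment> \<open>Commuting with \<open>f\<close>, the flow maps a Krylov vector of
    \<open>axis a 1\<close> to plus or minus the corresponding one of
    \<open>axis b 1\<close>.\<close>
  have flow_int: "int_vec (flow f t (g j))" for j
  proof -
    obtain k where "g j = (f ^^ k) (axis a 1)" using gKr by blast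
    then have "flow f t (g j) = \<epsilon> *\<^sub>R (f ^^ k) (axis b 1)"
      by (simp add: flow_commute_funpow[OF lin] assms(2) linear_scale[OF linear_funpow[OF lin]])
    then show ?thesis using int_vec_scaleR[OF \<open>\<epsilon> \<in> \<int>\<close> int_vec_funpow[OF int_vec_axis]] by simp
  qed
  \<comment> \<open>\<open>W *v row i\<close> lists the i-th coordinates of the integral vectors
    \<open>flow f t (g j)\<close>, so Cramer's rule writes each entry of \<open>row i\<close>, times
    the determinant, as an integral determinant.\<close>
  have row_det: "row i $ l * Determinants.det W \<in> \<int>" for i l
  proof -
    have "(W *v row i) $ j \<in> \<int>" for j
      using flow_int[of j] unfolding W inner_commute[of "g j"] row[symmetric] int_vec_def by blast
    then show ?thesis
      unfolding cramer_lemma[symmetric] using Wint by (intro det_Ints) auto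
  qed
  obtain z where z: "Determinants.det W = of_int z" using det_Ints[OF Wint] by (auto elim: Ints_cases)
  define D where "D = nat \<bar>z\<bar>"
  have "D \<ge> 1" unfolding D_def using det0 z by (simp add: Suc_le_eq)
  moreover have "real D * row i $ l \<in> \<int>" for i l
  proof -
    have "real D = Determinants.det W \<or> real D = - Determinants.det W" unfolding D_def z by auto
    then show ?thesis using row_det[of i l] by (auto simp: mult.commute)
  qed
  then have "int_vec (real D *\<^sub>R flow f t x)" if "int_vec x" for x
  proof -
    have "real D * (row i \<bullet> x) = (\<Sum>l\<in>UNIV. (real D * row i $ l) * x $ l)" for i
      by (simp add: inner_vec_def sum_distrib_left mult.assoc)
    moreover have "(\<Sum>l\<in>UNIV. (real D * row i $ l) * x $ l) \<in> \<int>" for i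
      using that \<open>\<And>i l. real D * row i $ l \<in> \<int>\<close> unfolding int_vec_def
      by (intro Ints_sum Ints_mult[of "real D * row i $ l" for i l]) auto
    ultimately show ?thesis unfolding int_vec_def by (simp add: row)
  qed
  ultimately show ?thesis by blast
qed

text \<open>The Hermitian matrix \<open>\<i> * S\<close>, as a map on complex vectors regarded as a
  real Euclidean space, to which the real spectral theory above applies.\<close>

definition H :: "complex ^ 'n \<Rightarrow> complex ^ 'n" where
  "H x = (\<chi> i. \<Sum>j\<in>UNIV. \<i> * of_real (S $ i $ j) * x $ j)"

definition spectrum :: "real set" where
  "spectrum = {\<theta>. \<exists>x. x \<noteq> 0 \<and> H x = \<theta> *\<^sub>R x}"

lemma linear_H: "linear H"
  by (rule linearI)
    (simp_all add: H_def Finite_Cartesian_Product.vec_eq_iff sum.distrib scaleR_sum_right algebra_simps)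

lemma H_scale: "H (c *s x) = c *s H x"
  by (simp add: H_def Finite_Cartesian_Product.vec_eq_iff sum_distrib_left mult_ac)

text \<open>For the real inner product both \<open>S\<close> and multiplication by
  \<open>\<i>\<close> are skew; they commute, so their product is symmetric.\<close>

lemma selfadjoint_H: "H x \<bullet> y = x \<bullet> H y"
proof -
  have "H x \<bullet> y = (\<Sum>i\<in>UNIV. \<Sum>j\<in>UNIV. (\<i> * of_real (S $ i $ j) * x $ j) \<bullet> y $ i)"
    by (simp add: inner_vec_def H_def inner_sum_left)
  also have "\<dots> = (\<Sum>j\<in>UNIV. \<Sum>i\<in>UNIV. x $ j \<bullet> (\<i> * of_real (S $ j $ i) * y $ i))"
    by (subst sum.swap, intro sum.cong refl, subst skew_entries)
      (simp add: inner_complex_def algebra_simps)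
  also have "\<dots> = x \<bullet> H y"
    by (simp add: inner_vec_def H_def inner_sum_right)
  finally show ?thesis .
qed

text \<open>Deliberately without conjugation: an eigenvector \<open>v\<close> of \<open>H\<close>
  for \<open>\<theta>\<close> acts as a left eigenvector of \<open>S\<close>, for the eigenvalue
  \<open>\<i> * \<theta>\<close>.\<close>

definition pairing :: "complex ^ 'n \<Rightarrow> real ^ 'n \<Rightarrow> complex" where
  "pairing v y = (\<Sum>b\<in>UNIV. v $ b * of_real (y $ b))"

lemma pairing_f:
  assumes "H v = \<theta> *\<^sub>R v"
  shows "pairing v (f y) = \<i> * of_real \<theta> * pairing v y"
proof -
  have Sv: "(\<Sum>b\<in>UNIV. of_real (S $ b $ a) * v $ b) = \<i> * of_real \<theta> * v $ a" for a
  proof -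
    have "(\<Sum>b\<in>UNIV. \<i> * of_real (S $ a $ b) * v $ b) = of_real \<theta> * v $ a"
      using arg_cong[OF assms, of "\<lambda>x. x $ a"]
      by (simp add: H_def scaleR_conv_of_real[where 'a = complex])
    moreover have "(\<Sum>b\<in>UNIV. \<i> * of_real (S $ a $ b) * v $ b)
        = - \<i> * (\<Sum>b\<in>UNIV. of_real (S $ b $ a) * v $ b)"
      unfolding sum_distrib_left by (intro sum.cong refl, subst skew_entries) simp
    ultimately have "\<i> * (- \<i> * (\<Sum>b\<in>UNIV. of_real (S $ b $ a) * v $ b)) = \<i> * (of_real \<theta> * v $ a)" by simp
    then show ?thesis by (simp add: mult.assoc[symmetric])
  qed
  have "pairing v (f y) = (\<Sum>b\<in>UNIV. \<Sum>a\<in>UNIV. (of_real (S $ b $ a) * v $ b) * of_real (y $ a))"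
    by (simp add: pairing_def matrix_vector_mult_def sum_distrib_left mult_ac)
  also have "\<dots> = (\<Sum>a\<in>UNIV. (\<Sum>b\<in>UNIV. of_real (S $ b $ a) * v $ b) * of_real (y $ a))"
    by (subst sum.swap) (simp add: sum_distrib_right)
  finally show ?thesis unfolding Sv by (simp add: pairing_def sum_distrib_left mult_ac)
qed

lemma pairing_axis: "pairing v (axis a 1) = v $ a"
proof -
  have "pairing v (axis a 1) = (\<Sum>b\<in>UNIV. if b = a then v $ b else 0)"
    unfolding pairing_def by (intro sum.cong refl) (simp add: axis_def)
  then show ?thesis by simp
qed

text \<open>If the coordinate at \<open>a\<close> vanishes, the pairing kills every Krylov vector of
  \<open>axis a 1\<close>; cyclicity then applies to the real and the imaginary part of
  \<open>v\<close>.\<close>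

lemma eigenvector_entry_nonzero:
  assumes "H v = \<theta> *\<^sub>R v" "v $ a = 0"
  shows "v = 0"
proof -
  have 0: "pairing v ((f ^^ k) (axis a 1)) = 0" for k
    by (induction k) (simp_all add: pairing_axis assms(2) pairing_f[OF assms(1)])
  define x y where "x = (\<chi> b. Re (v $ b))" and "y = (\<chi> b. Im (v $ b))"
  have "x \<bullet> z = Re (pairing v z)" "y \<bullet> z = Im (pairing v z)" for z
    by (simp_all add: x_def y_def pairing_def inner_vec_def)
  then have "x = 0" "y = 0" using 0 by (auto intro!: cyclic[of _ a])
  then show ?thesis by (simp add: x_def y_def Finite_Cartesian_Product.vec_eq_iff complex_eq_iff)
qed

text \<open>Reading off one coordinate is injective on an eigenspace, hence a bijection onto the
  complex numbers: complex multiplicity one, real dimension two.\<close>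

lemma eigenspace_dim:
  assumes "\<exists>x. x \<noteq> 0 \<and> H x = \<theta> *\<^sub>R x"
  shows "dim {x. H x = \<theta> *\<^sub>R x} = 2"
proof -
  define E where "E = {x. H x = \<theta> *\<^sub>R x}"
  obtain x where x: "x \<noteq> 0" "H x = \<theta> *\<^sub>R x" using assms by blast
  fix a :: 'n
  have sub: "subspace E"
    unfolding E_def
    by (auto simp: subspace_def linear_0[OF linear_H] linear_add[OF linear_H] linear_scale[OF linear_H] algebra_simps)
  have lin: "linear (\<lambda>v :: complex ^ 'n. v $ a)" by (rule linearI) auto
  have "inj_on (\<lambda>v. v $ a) E"
  proof (rule inj_onI)
    fix v w assume "v \<in> E" "w \<in> E" "v $ a = w $ a"
    then have "H (v - w) = \<theta> *\<^sub>R (v - w)" "(v - w) $ a = 0"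
      by (auto simp: E_def linear_diff[OF linear_H] algebra_simps)
    then have "v - w = 0" by (rule eigenvector_entry_nonzero)
    then show "v = w" by simp
  qed
  then have "dim ((\<lambda>v. v $ a) ` E) = dim E"
    using sub by (intro dim_image_eq lin) (simp add: span_eq_iff[THEN iffD2])
  moreover have "(\<lambda>v. v $ a) ` E = UNIV"
  proof -
    have "x $ a \<noteq> 0" using eigenvector_entry_nonzero x by blast
    moreover have "(z / x $ a) *s x \<in> E" for z
      using x(2) by (simp add: E_def H_scale Finite_Cartesian_Product.vec_eq_iff)
    ultimately have "z = ((z / x $ a) *s x) $ a \<and> (z / x $ a) *s x \<in> E" for z by simp
    then show ?thesis by blast
  qed
  ultimately show ?thesis by (simp add: E_def dim_UNIV)
qed

text \<open>\<open>S\<close> is real, so conjugating an eigenvector of \<open>\<i> * S\<close>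
  reverses the sign of the eigenvalue.\<close>

lemma spectrum_uminus:
  assumes "\<theta> \<in> spectrum"
  shows "- \<theta> \<in> spectrum"
proof -
  obtain x where x: "x \<noteq> 0" "H x = \<theta> *\<^sub>R x" using assms unfolding spectrum_def by blast
  define y where "y = (\<chi> i. cnj (x $ i))"
  have "y \<noteq> 0" using x(1) by (auto simp: y_def Finite_Cartesian_Product.vec_eq_iff)
  moreover have "H y $ i = (- \<theta> *\<^sub>R y) $ i" for i
  proof -
    have "H y $ i = - cnj (H x $ i)" by (simp add: H_def y_def sum_negf)
    then show ?thesis by (simp add: x(2) y_def)
  qed
  ultimately show ?thesis unfolding spectrum_def by (auto simp: Finite_Cartesian_Product.vec_eq_iff)
qed

lemma H_funpow_real: "(H ^^ j) (\<chi> i. of_real (x $ i)) = \<i> ^ j *s (\<chi> i. of_real ((f ^^ j) x $ i))"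
proof (induction j)
  case (Suc j)
  have "H (\<chi> i. of_real (y $ i)) = \<i> *s (\<chi> i. of_real (f y $ i))" for y :: "real ^ 'n"
    by (simp add: H_def Finite_Cartesian_Product.vec_eq_iff matrix_vector_mult_def sum_distrib_left mult_ac)
  then show ?case by (simp add: Suc H_scale mult_ac)
qed simp

lemma H_funpow_scale: "(H ^^ j) (c *s x) = c *s (H ^^ j) x"
  by (induction j) (simp_all add: H_scale)

text \<open>The real trace meets every vertex twice, through \<open>axis b 1\<close> and
  \<open>axis b \<i>\<close>. This factor 2 cancels against the dimension of the eigenspaces in the
  power sums below.\<close>

lemma trace_H_power:
  "(\<Sum>e\<in>Basis. (H ^^ (2 * m)) e \<bullet> e) = 2 * real CARD('n) * ((- 1) ^ m * (f ^^ (2 * m)) (axis a 1) $ a)"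
proof -
  define F where "F = H ^^ (2 * m)"
  define c where "c = (- 1) ^ m * (f ^^ (2 * m)) (axis a 1) $ a"
  have ax: "axis b (1::complex) = (\<chi> i. of_real (axis b 1 $ i))" for b :: 'n
    by (simp add: axis_def Finite_Cartesian_Product.vec_eq_iff)
  have F1: "F (axis b 1) $ b = of_real c" for b
    unfolding F_def ax H_funpow_real c_def diagonal_constant[of "2 * m" a b] by (simp add: power_mult)
  have axi: "axis b \<i> = \<i> *s axis b 1" for b :: 'n
    by (simp add: axis_def Finite_Cartesian_Product.vec_eq_iff)
  have Fi: "F (axis b \<i>) $ b = \<i> * of_real c" for b
    unfolding axi F_def H_funpow_scale using F1[of b] by (simp add: F_def)
  have "(\<Sum>e\<in>Basis. F e \<bullet> e) = (\<Sum>(b, u)\<in>UNIV \<times> {1, \<i>}. F (axis b u) \<bullet> axis b u)"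
    by (rule sum.reindex_cong[where l = "\<lambda>(b, u). axis b u"])
      (auto simp: inj_on_def axis_eq_axis Basis_vec_def Basis_complex_def)
  also have "\<dots> = (\<Sum>b\<in>(UNIV :: 'n set). 2 * c)"
    by (simp add: sum.cartesian_product[symmetric] inner_axis F1 Fi complex_inner_1_right inner_complex_def)
  finally show ?thesis unfolding F_def c_def by simp
qed

lemma finite_spectrum: "finite spectrum"
  and card_spectrum: "card spectrum = CARD('n)"
  and spectrum_power_sum: "(\<Sum>\<theta>\<in>spectrum. \<theta> ^ (2 * m)) = real CARD('n) * ((- 1) ^ m * (f ^^ (2 * m)) (axis a 1) $ a)"
proof -
  note * = selfadjoint_power_sums[of H 2, OF linear_H selfadjoint_H eigenspace_dim, folded spectrum_def]
  show "finite spectrum" by (rule *(1))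
  show "card spectrum = CARD('n)" using *(2) by simp
  show "(\<Sum>\<theta>\<in>spectrum. \<theta> ^ (2 * m)) = real CARD('n) * ((- 1) ^ m * (f ^^ (2 * m)) (axis a 1) $ a)"
    using *(3)[of "2 * m"] unfolding trace_H_power[of m a] by simp
qed

text \<open>Two distinct vertices are needed to have a nonzero transfer time; the Gelfond-Schneider
  argument then runs on the tensor square of the real vector space.\<close>

lemma spectrum_linear_dependence:
  assumes \<theta>: "\<theta> \<in> spectrum" and \<mu>: "\<mu> \<in> spectrum" and two: "CARD('n) \<ge> 2"
  shows "\<exists>p q :: int. (p, q) \<noteq> (0, 0) \<and> of_int p * \<theta> + of_int q * \<mu> = 0"
proof -
  obtain v where v: "v \<noteq> 0" "H v = \<theta> *\<^sub>R v" using \<theta> unfolding spectrum_def by blast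
  obtain w where w: "w \<noteq> 0" "H w = \<mu> *\<^sub>R w" using \<mu> unfolding spectrum_def by blast
  obtain a b :: 'n where ab: "a \<noteq> b"
    using two by (metis (full_types) UNIV_I card_le_Suc0_iff_eq finite not_less_eq_eq numeral_2_eq_2)
  obtain \<tau> \<epsilon> where \<tau>: "\<bar>\<epsilon>\<bar> = 1" "flow f \<tau> (axis a 1) = \<epsilon> *\<^sub>R axis b 1" using transitive' by blast
  have "\<tau> \<noteq> 0"
  proof
    assume "\<tau> = 0"
    then have "axis a (1::real) $ a = (\<epsilon> *\<^sub>R axis b 1) $ a" using \<tau>(2) by simp
    then show False using ab by (simp add: axis_def)
  qed
  obtain D :: nat where D: "D \<ge> 1" "\<And>x. int_vec x \<Longrightarrow> int_vec (real D *\<^sub>R flow f \<tau> x)"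
    using flow_rational[OF \<tau>] by blast
  define e :: "real ^ 'n" where "e = axis a 1"
  have int_flow: "int_vec (real D ^ m *\<^sub>R flow f (real m * \<tau>) e)" for m
  proof (induction m)
    case 0
    then show ?case by (simp add: e_def int_vec_axis)
  next
    case (Suc m)
    have "flow f (real (Suc m) * \<tau>) e = flow f \<tau> (flow f (real m * \<tau>) e)"
      unfolding flow_mult_nat by simp
    then have "real D ^ Suc m *\<^sub>R flow f (real (Suc m) * \<tau>) e
        = real D *\<^sub>R flow f \<tau> (real D ^ m *\<^sub>R flow f (real m * \<tau>) e)"
      by (simp add: linear_scale[OF linear_flow])
    then show ?case using D(2)[OF Suc] by simp
  qed
  \<comment> \<open>\<open>A\<close> and \<open>B\<close> below apply \<open>S\<close> to the first
    and to the second tensor factor. Pairing with the tensor of \<open>v\<close> and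
    \<open>w\<close> is an eigenfunctional of both, with eigenvalues \<open>\<i> * \<theta>\<close>
    and \<open>\<i> * \<mu>\<close>.\<close>
  define tensor :: "real ^ 'n \<Rightarrow> real ^ 'n \<Rightarrow> real ^ ('n \<times> 'n)"
    where "tensor x y = (\<chi> p. x $ fst p * y $ snd p)" for x y
  define A :: "real ^ ('n \<times> 'n) \<Rightarrow> real ^ ('n \<times> 'n)"
    where "A x = (\<chi> p. \<Sum>c\<in>UNIV. S $ fst p $ c * x $ (c, snd p))" for x
  define B :: "real ^ ('n \<times> 'n) \<Rightarrow> real ^ ('n \<times> 'n)"
    where "B x = (\<chi> p. \<Sum>c\<in>UNIV. S $ snd p $ c * x $ (fst p, c))" for x
  define \<xi> where "\<xi> k l z = tensor (flow f (real k * z * \<tau>) e) (flow f (real l * z * \<tau>) e)" for k l :: nat and z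
  define \<omega> :: "real ^ ('n \<times> 'n) \<Rightarrow> complex"
    where "\<omega> x = (\<Sum>p\<in>UNIV. v $ fst p * w $ snd p * of_real (x $ p))" for x
  have tensor_A: "A (tensor x y) = tensor (f x) y" for x y
    by (simp add: A_def tensor_def Finite_Cartesian_Product.vec_eq_iff matrix_vector_mult_def sum_distrib_right mult.assoc)
  have tensor_B: "B (tensor x y) = tensor x (f y)" for x y
    by (simp add: B_def tensor_def Finite_Cartesian_Product.vec_eq_iff matrix_vector_mult_def sum_distrib_left mult_ac)
  have tensor_bilinear: "bounded_bilinear tensor"
    unfolding bilinear_conv_bounded_bilinear[symmetric] bilinear_def
    by (auto intro!: linearI simp: tensor_def Finite_Cartesian_Product.vec_eq_iff algebra_simps)
  have sum_pair: "(\<Sum>p\<in>UNIV. g p) = (\<Sum>i\<in>UNIV. \<Sum>j\<in>UNIV. g (i, j))" for g :: "'n \<times> 'n \<Rightarrow> 'b :: comm_monoid_add"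
    by (simp add: sum.cartesian_product UNIV_Times_UNIV)
  have norm_tensor: "norm (tensor x y) = norm x * norm y" for x y
  proof -
    have "tensor x y \<bullet> tensor x y = (x \<bullet> x) * (y \<bullet> y)"
      unfolding inner_vec_def sum_pair sum_product by (simp add: tensor_def mult_ac)
    then show ?thesis by (simp add: norm_eq_sqrt_inner real_sqrt_mult)
  qed
  have "\<exists>p q :: int. (p, q) \<noteq> (0, 0) \<and> of_int p * (\<i> * of_real \<theta>) + of_int q * (\<i> * of_real \<mu>) = 0"
  proof (rule gelfond_schneider_vector[of A B \<omega> \<xi> \<tau> D])
    show "linear A"
      by (auto intro!: linearI simp: A_def Finite_Cartesian_Product.vec_eq_iff sum.distrib sum_distrib_left algebra_simps)
    show "linear B"
      by (auto intro!: linearI simp: B_def Finite_Cartesian_Product.vec_eq_iff sum.distrib sum_distrib_left algebra_simps)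
    show "linear \<omega>"
      by (auto intro!: linearI simp: \<omega>_def sum.distrib sum_distrib_left algebra_simps scaleR_conv_of_real[where 'a = complex])
    show "int_vec (A x)" if "int_vec x" for x
      using that int_entries unfolding int_vec_def A_def by (auto intro!: Ints_sum Ints_mult)
    show "int_vec (B x)" if "int_vec x" for x
      using that int_entries unfolding int_vec_def B_def by (auto intro!: Ints_sum Ints_mult)
    have flow_der: "((\<lambda>z. flow f (real k * z * \<tau>) e) has_vector_derivative (real k * \<tau>) *\<^sub>R f (flow f (real k * z * \<tau>) e)) (at z)" for k z
    proof -
      have "((\<lambda>z. real k * z * \<tau>) has_vector_derivative real k * \<tau>) (at z)"
        by (auto intro!: derivative_eq_intros)
      from vector_diff_chain_at[OF this flow_has_vector_derivative[OF lin, of e "real k * z * \<tau>"]]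
      show ?thesis by (simp add: o_def)
    qed
    show "(\<xi> k l has_vector_derivative \<tau> *\<^sub>R (real k *\<^sub>R A (\<xi> k l z) + real l *\<^sub>R B (\<xi> k l z))) (at z)" for k l z
      using bounded_bilinear.has_vector_derivative[OF tensor_bilinear flow_der[of k z] flow_der[of l z]]
      unfolding \<xi>_def tensor_A tensor_B
      by (simp add: bounded_bilinear.scaleR_left[OF tensor_bilinear] bounded_bilinear.scaleR_right[OF tensor_bilinear]
          scaleR_add_right mult.commute add.commute)
    show "norm (\<xi> k l z) \<le> 1" for k l z
      by (simp add: \<xi>_def norm_tensor norm_flow e_def)
    show "int_vec (real D ^ ((k + l) * m) *\<^sub>R \<xi> k l (real m))" for k l m
    proof -
      have "real D ^ ((k + l) * m) *\<^sub>R \<xi> k l (real m)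
          = tensor (real D ^ (k * m) *\<^sub>R flow f (real (k * m) * \<tau>) e) (real D ^ (l * m) *\<^sub>R flow f (real (l * m) * \<tau>) e)"
        unfolding distrib_right power_add
        by (simp add: \<xi>_def tensor_def Finite_Cartesian_Product.vec_eq_iff mult_ac)
      then show ?thesis
        using int_flow[of "k * m"] int_flow[of "l * m"] unfolding int_vec_def tensor_def by (auto intro: Ints_mult)
    qed
    show "\<omega> (A x) = \<i> * of_real \<theta> * \<omega> x" for x
    proof -
      have \<omega>: "\<omega> x = (\<Sum>j\<in>UNIV. w $ j * pairing v (\<chi> i. x $ (i, j)))" for x
        unfolding \<omega>_def sum_pair pairing_def sum_distrib_left by (subst sum.swap) (simp add: mult_ac)
      have "(\<chi> i. A x $ (i, j)) = f (\<chi> i. x $ (i, j))" for j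
        by (simp add: A_def Finite_Cartesian_Product.vec_eq_iff matrix_vector_mult_def)
      then show ?thesis
        unfolding \<omega> by (simp add: pairing_f[OF v(2)] sum_distrib_left mult_ac)
    qed
    show "\<omega> (B x) = \<i> * of_real \<mu> * \<omega> x" for x
    proof -
      have \<omega>: "\<omega> x = (\<Sum>i\<in>UNIV. v $ i * pairing w (\<chi> j. x $ (i, j)))" for x
        unfolding \<omega>_def sum_pair pairing_def sum_distrib_left by (simp add: mult_ac)
      have "(\<chi> j. B x $ (i, j)) = f (\<chi> j. x $ (i, j))" for i
        by (simp add: B_def Finite_Cartesian_Product.vec_eq_iff matrix_vector_mult_def)
      then show ?thesis
        unfolding \<omega> by (simp add: pairing_f[OF w(2)] sum_distrib_left mult_ac)
    qed
    show "\<omega> (\<xi> k l 0) = v $ a * w $ a" for k l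
    proof -
      have "\<omega> (\<xi> k l 0) = pairing v e * pairing w e"
        unfolding \<omega>_def sum_pair pairing_def sum_product by (simp add: \<xi>_def tensor_def mult_ac)
      then show ?thesis by (simp add: e_def pairing_axis)
    qed
    show "v $ a * w $ a \<noteq> 0"
      using eigenvector_entry_nonzero v w by auto
  qed (use \<open>\<tau> \<noteq> 0\<close> D(1) in auto)
  then obtain p q :: int where pq: "(p, q) \<noteq> (0, 0)"
    "of_int p * (\<i> * of_real \<theta>) + of_int q * (\<i> * of_real \<mu>) = (0 :: complex)" by blast
  have "\<i> * of_real (of_int p * \<theta> + of_int q * \<mu>) = (0 :: complex)"
    using pq(2) by (simp add: algebra_simps)
  then have "of_int p * \<theta> + of_int q * \<mu> = 0" by (metis complex_i_not_zero mult_eq_0_iff of_real_eq_0_iff)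
  then show ?thesis using pq(1) by blast
qed

text \<open>Squares are used because \<open>H\<close> itself has imaginary entries, while its square
  is the integer matrix of minus \<open>S\<close> squared.\<close>

lemma spectrum_square_algebraic_int:
  assumes "\<theta> \<in> spectrum"
  shows "algebraic_int (\<theta> ^ 2)"
proof -
  obtain x where x: "x \<noteq> 0" "H x = \<theta> *\<^sub>R x" using assms unfolding spectrum_def by blast
  define s where "s i j = \<lfloor>S $ i $ j\<rfloor>" for i j
  have s: "S $ i $ j = of_int (s i j)" for i j
    unfolding s_def using int_entries by simp
  obtain a where "x $ a \<noteq> 0" using x(1) by (auto simp: Finite_Cartesian_Product.vec_eq_iff)
  have "H (H x) = \<theta> ^ 2 *\<^sub>R x" by (simp add: x(2) linear_scale[OF linear_H] power2_eq_square)
  then have HH: "H (H x) $ i = of_real (\<theta> ^ 2) * x $ i" for i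
    by (simp add: scaleR_conv_of_real[where 'a = complex])
  have "(\<Sum>l\<in>UNIV. of_int (- (\<Sum>j\<in>UNIV. s i j * s j l)) * x $ l) = H (H x) $ i" for i
  proof -
    have "H (H x) $ i = (\<Sum>j\<in>UNIV. \<Sum>l\<in>UNIV. - (of_int (s i j * s j l) * x $ l))"
      by (simp add: H_def s sum_distrib_left mult_ac sum_negf)
    also have "\<dots> = (\<Sum>l\<in>UNIV. of_int (- (\<Sum>j\<in>UNIV. s i j * s j l)) * x $ l)"
      by (subst sum.swap) (simp add: sum_negf sum_distrib_right)
    finally show ?thesis by simp
  qed
  then have "algebraic_int (of_real (\<theta> ^ 2) :: complex)"
    using HH \<open>x $ a \<noteq> 0\<close>
    by (intro algebraic_int_eigenvalue[of "\<lambda>i l. - (\<Sum>j\<in>UNIV. s i j * s j l)" "\<lambda>i. x $ i" _ a]) auto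
  then show ?thesis by (simp only: algebraic_int_of_real_iff)
qed

lemma spectrum_power_sum_int: "\<exists>c :: int. (\<Sum>\<theta>\<in>spectrum. \<theta> ^ (2 * m)) = real CARD('n) * of_int c"
proof -
  fix a :: 'n
  have "(f ^^ (2 * m)) (axis a 1) $ a \<in> \<int>"
    using int_vec_funpow[OF int_vec_axis] by (simp add: int_vec_def)
  then have "(- 1) ^ m * (f ^^ (2 * m)) (axis a 1) $ a \<in> \<int>" by (intro Ints_mult Ints_power) auto
  then obtain c where "(- 1) ^ m * (f ^^ (2 * m)) (axis a 1) $ a = of_int c" by (elim Ints_cases)
  then show ?thesis using spectrum_power_sum[of m a] by metis
qed

text \<open>For a graph the last sum is the degree of \<open>a\<close>; as the left side does not
  mention \<open>a\<close>, this already makes the graph regular.\<close>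

lemma spectrum_square_sum: "(\<Sum>\<theta>\<in>spectrum. \<theta> ^ 2) = real CARD('n) * (\<Sum>i\<in>UNIV. (S $ i $ a) ^ 2)"
proof -
  have "(\<Sum>i\<in>UNIV. (S $ i $ a) ^ 2) = f (axis a 1) \<bullet> f (axis a 1)"
    by (simp add: inner_vec_def matrix_vector_mult_basis column_def power2_eq_square)
  also have "\<dots> = - (f (f (axis a 1)) $ a)"
    using skew[of "axis a 1" "f (axis a 1)"] by (simp add: inner_axis')
  finally show ?thesis using spectrum_power_sum[of 1 a] by (simp add: numeral_2_eq_2)
qed

text \<open>All eigenvalues are rational multiples of a nonzero \<open>\<theta>\<close>, so the
  integral trace of the square of \<open>H\<close> makes \<open>\<theta> ^ 2\<close>, and then every
  product, rational. Being algebraic integers, the products are integers.\<close>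

lemma spectrum_products_int:
  assumes two: "CARD('n) \<ge> 2" and \<theta>\<mu>: "\<theta> \<in> spectrum" "\<mu> \<in> spectrum"
  shows "\<theta> * \<mu> \<in> \<int>"
proof (cases "\<theta> = 0")
  case False
  have "\<exists>q\<in>\<rat>. \<nu> = q * \<theta>" if "\<nu> \<in> spectrum" for \<nu>
  proof -
    obtain p q :: int where pq: "(p, q) \<noteq> (0, 0)" "of_int p * \<theta> + of_int q * \<nu> = 0"
      using spectrum_linear_dependence[OF \<theta>\<mu>(1) \<open>\<nu> \<in> spectrum\<close> two] by blast
    have "q \<noteq> 0" using pq False by auto
    then have "\<nu> = (- of_int p / of_int q) * \<theta>" using pq(2) by (simp add: field_simps)
    then show ?thesis by (intro bexI[of _ "- of_int p / of_int q"]) auto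
  qed
  then obtain r where r: "\<And>\<nu>. \<nu> \<in> spectrum \<Longrightarrow> r \<nu> \<in> \<rat> \<and> \<nu> = r \<nu> * \<theta>" by metis
  obtain c :: int where c: "(\<Sum>\<nu>\<in>spectrum. \<nu> ^ 2) = real CARD('n) * of_int c"
    using spectrum_power_sum_int[of 1] by auto
  have "(\<Sum>\<nu>\<in>spectrum. \<nu> ^ 2) = (\<Sum>\<nu>\<in>spectrum. (r \<nu> * \<theta>) ^ 2)"
    using r by (intro sum.cong refl) metis
  then have "(\<Sum>\<nu>\<in>spectrum. \<nu> ^ 2) = (\<Sum>\<nu>\<in>spectrum. r \<nu> ^ 2) * \<theta> ^ 2"
    by (simp add: power_mult_distrib sum_distrib_right)
  moreover have "(\<Sum>\<nu>\<in>spectrum. \<nu> ^ 2) \<ge> \<theta> ^ 2"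
    using finite_spectrum \<theta>\<mu>(1) by (intro member_le_sum) auto
  then have "(\<Sum>\<nu>\<in>spectrum. \<nu> ^ 2) \<noteq> 0" using False by (metis zero_less_power2 not_less)
  ultimately have "\<theta> ^ 2 = real CARD('n) * of_int c / (\<Sum>\<nu>\<in>spectrum. r \<nu> ^ 2)"
    using c by (auto simp: field_simps)
  moreover have "(\<Sum>\<nu>\<in>spectrum. r \<nu> ^ 2) \<in> \<rat>" using r by (intro Rats_sum Rats_power) auto
  ultimately have \<theta>2: "\<theta> ^ 2 \<in> \<rat>" by auto
  have rat: "\<theta> * \<nu> \<in> \<rat>" "\<nu> ^ 2 \<in> \<rat>" if "\<nu> \<in> spectrum" for \<nu>
  proof -
    have "\<theta> * \<nu> = r \<nu> * \<theta> ^ 2" "\<nu> ^ 2 = r \<nu> ^ 2 * \<theta> ^ 2"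
      using r[OF that] by (simp_all add: power2_eq_square) (metis mult.commute mult.left_commute)+
    then show "\<theta> * \<nu> \<in> \<rat>" "\<nu> ^ 2 \<in> \<rat>" using r[OF that] \<theta>2 by auto
  qed
  have "\<theta> ^ 2 \<in> \<int>" "\<mu> ^ 2 \<in> \<int>"
    using rational_algebraic_int_is_int spectrum_square_algebraic_int rat(2) \<theta>\<mu> by blast+
  then have "(\<theta> * \<mu>) ^ 2 \<in> \<int>" by (simp add: power_mult_distrib)
  \<comment> \<open>The square root is the absolute value of \<open>\<theta> * \<mu>\<close>, and
    the sign does not affect integrality.\<close>
  then have "algebraic_int (sqrt ((\<theta> * \<mu>) ^ 2))" by (intro algebraic_int_sqrt int_imp_algebraic_int)
  then have "algebraic_int (\<theta> * \<mu>)" by simp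
  then show ?thesis using rational_algebraic_int_is_int rat(1) \<theta>\<mu>(2) by blast
qed simp

text \<open>The spectral bound is applied at every vertex with \<open>k\<close> its degree;
  \<open>k = n - 1\<close> means adjacency to all other vertices.\<close>

theorem card_le_3_and_complete:
  assumes two: "CARD('n) \<ge> 2" and entries: "\<And>i j. S $ i $ j \<in> {-1, 0, 1}"
  shows "CARD('n) \<le> 3" and "i \<noteq> j \<Longrightarrow> S $ i $ j \<noteq> 0"
proof -
  define N where "N a = {i. S $ i $ a \<noteq> 0}" for a
  have diag: "S $ a $ a = 0" for a using skew_entries[of a a] by simp
  have sub: "N a \<subseteq> UNIV - {a}" for a using diag by (auto simp: N_def)
  have key: "CARD('n) \<le> 3 \<and> card (N a) = CARD('n) - 1" for a
  proof (rule integral_symmetric_spectrum[OF finite_spectrum card_spectrum two spectrum_uminus spectrum_products_int[OF two]])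
    have "(S $ i $ a) ^ 2 = (if i \<in> N a then 1 else 0)" for i
      using entries[of i a] by (auto simp: N_def)
    then have "(\<Sum>i\<in>UNIV. (S $ i $ a) ^ 2) = real (card (N a))" by (simp add: sum.If_cases)
    then show "(\<Sum>\<theta>\<in>spectrum. \<theta> ^ 2) = real CARD('n) * real (card (N a))"
      using spectrum_square_sum[of a] by simp
    have "card (N a) \<le> card (UNIV - {a})" using sub by (intro card_mono) auto
    then show "card (N a) < CARD('n)" using two by (simp add: card_Diff_singleton)
  qed (auto intro: spectrum_power_sum_int)
  then show "CARD('n) \<le> 3" by blast
  show "S $ i $ j \<noteq> 0" if "i \<noteq> j" for i j
  proof -
    have "N j = UNIV - {j}" using sub[of j] key[of j] by (intro card_subset_eq) (auto simp: card_Diff_singleton)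
    then show ?thesis using that unfolding N_def by auto
  qed
qed

end

section \<open>Oriented graphs\<close>

definition skew_adjacency :: "'v::finite pair_pre_digraph \<Rightarrow> real ^ 'v ^ 'v" where
  "skew_adjacency X = (\<chi> a b. if (a, b) \<in> parcs X then 1 else if (b, a) \<in> parcs X then -1 else 0)"

lemma hermitian_matrix_eq: "hermitian_matrix X $ a $ b = \<i> * of_real (skew_adjacency X $ a $ b)"
  by (simp add: hermitian_matrix_def skew_adjacency_def)

text \<open>The factor \<open>- \<i>\<close> in the exponent cancels the \<open>\<i>\<close> of the
  Hermitian matrix, leaving the real matrix \<open>t\<close> times \<open>S\<close>.\<close>

lemma transition_matrix_eq_flow:
  "transition_matrix X t *v (\<chi> i. of_real (x $ i)) = (\<chi> i. of_real (flow ((*v) (skew_adjacency X)) t x $ i))"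
proof -
  define S where "S = skew_adjacency X"
  define A where "A = (\<chi> a b. - \<i> * complex_of_real t * hermitian_matrix X $ a $ b)"
  define cv where "cv x = (\<chi> i. complex_of_real (x $ i))" for x :: "real ^ 'a"
  have lin: "linear ((*v) S)" by simp
  have A: "A *v cv x = cv (t *\<^sub>R (S *v x))" for x
    by (simp add: A_def cv_def hermitian_matrix_eq S_def matrix_vector_mult_def sum_distrib_left mult_ac
        Finite_Cartesian_Product.vec_eq_iff)
  have power: "matrix_power A k *v cv x = cv (t ^ k *\<^sub>R ((*v) S ^^ k) x)" for k
  proof (induction k)
    case (Suc k)
    have "matrix_power A (Suc k) *v cv x = A *v (matrix_power A k *v cv x)"
      by (simp add: matrix_vector_mul_assoc)
    then show ?case by (simp add: Suc A linear_scale[OF lin])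
  qed simp
  have lin_cv: "linear cv"
    by (rule linearI) (simp_all add: cv_def Finite_Cartesian_Product.vec_eq_iff scaleR_conv_of_real[where 'a = complex])
  have "linear (\<lambda>M :: complex ^ 'a ^ 'a. M *v cv x)"
    by (rule linearI)
      (simp_all add: matrix_vector_mult_def Finite_Cartesian_Product.vec_eq_iff scaleR_sum_right algebra_simps sum.distrib)
  then have lin_mult: "bounded_linear (\<lambda>M :: complex ^ 'a ^ 'a. M *v cv x)"
    by (simp add: linear_conv_bounded_linear)
  have "(\<lambda>k. (matrix_power A k /\<^sub>R fact k) *v cv x) sums (matrix_exp A *v cv x)"
    by (rule bounded_linear.sums[OF lin_mult matrix_exp_sums])
  moreover have "(matrix_power A k /\<^sub>R fact k) *v cv x = (t ^ k / fact k) *\<^sub>R cv (((*v) S ^^ k) x)" for k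
    using linear_scale[OF bounded_linear.linear[OF lin_mult], of "inverse (fact k)" "matrix_power A k"]
    by (simp add: power linear_scale[OF lin_cv] divide_inverse mult.commute)
  ultimately have "(\<lambda>k. (t ^ k / fact k) *\<^sub>R cv (((*v) S ^^ k) x)) sums (matrix_exp A *v cv x)" by simp
  moreover have "(\<lambda>k. (t ^ k / fact k) *\<^sub>R cv (((*v) S ^^ k) x)) sums cv (flow ((*v) S) t x)"
    by (rule flow_bounded_linear_sums[OF lin]) (use lin_cv linear_conv_bounded_linear in blast)
  ultimately have "matrix_exp A *v cv x = cv (flow ((*v) S) t x)" by (rule sums_unique2)
  then show ?thesis unfolding cv_def S_def transition_matrix_def A_def .
qed

text \<open>The flow is real, so a phase of modulus one can only be a sign.\<close>

lemma perfect_state_transfer_flow: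
  assumes "perfect_state_transfer X a b t"
  shows "\<exists>\<epsilon>. \<bar>\<epsilon>\<bar> = 1 \<and> flow ((*v) (skew_adjacency X)) t (axis a 1) = \<epsilon> *\<^sub>R axis b 1"
proof -
  let ?u = "flow ((*v) (skew_adjacency X)) t (axis a 1)"
  obtain \<alpha> where \<alpha>: "norm \<alpha> = 1" "transition_matrix X t *v axis a 1 = \<alpha> *s axis b 1"
    using assms unfolding perfect_state_transfer_def by blast
  have "axis a (1::complex) = (\<chi> i. of_real (axis a 1 $ i))"
    by (simp add: axis_def Finite_Cartesian_Product.vec_eq_iff)
  then have eq: "(\<chi> i. of_real (?u $ i)) = \<alpha> *s axis b 1"
    using \<alpha>(2) transition_matrix_eq_flow[of X t "axis a 1"] by simp
  have *: "complex_of_real (?u $ i) = (if i = b then \<alpha> else 0)" for i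
    using arg_cong[OF eq, of "\<lambda>v. v $ i"] by (simp add: axis_def)
  have "\<bar>?u $ b\<bar> = 1" using *[of b] \<alpha>(1) by (metis norm_of_real)
  moreover have "?u = ?u $ b *\<^sub>R axis b 1"
    unfolding Finite_Cartesian_Product.vec_eq_iff
  proof
    show "?u $ i = (?u $ b *\<^sub>R axis b 1) $ i" for i
      using *[of i] by (cases "i = b") (simp_all add: axis_def)
  qed
  ultimately show ?thesis by blast
qed

theorem theorem3p5:
  fixes X :: "'v::finite pair_pre_digraph"
  assumes "oriented_graph X"
    and "pverts X = UNIV"
    and "card (pverts X) \<ge> 2"
    and "universal_perfect_state_transfer X"
  shows "complete_digraph 2 (with_proj (mk_symmetric (with_proj X))) \<or>
         complete_digraph 3 (with_proj (mk_symmetric (with_proj X)))"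
proof -
  interpret oriented_graph X by fact
  let ?S = "skew_adjacency X"
  have asym: "(b, a) \<notin> parcs X" if "(a, b) \<in> parcs X" for a b
    using asym_arcs that by (auto dest: asymD)
  interpret transitive_flow ?S
  proof
    show "?S $ i $ j = - ?S $ j $ i" for i j
      using asym by (auto simp: skew_adjacency_def)
    show "?S $ i $ j \<in> \<int>" for i j
      by (simp add: skew_adjacency_def)
    show "\<exists>t \<epsilon>. \<bar>\<epsilon>\<bar> = 1 \<and> flow ((*v) ?S) t (axis a 1) = \<epsilon> *\<^sub>R axis b 1" if "a \<noteq> b" for a b
      using assms(2,4) that perfect_state_transfer_flow unfolding universal_perfect_state_transfer_def by blast
  qed
  have two: "CARD('v) \<ge> 2" using assms(2,3) by simp
  have entries: "?S $ i $ j \<in> {-1, 0, 1}" for i j by (simp add: skew_adjacency_def)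
  have "(i, j) \<in> parcs X \<or> (j, i) \<in> parcs X" if "i \<noteq> j" for i j
    using card_le_3_and_complete(2)[OF two entries that] by (auto simp: skew_adjacency_def split: if_splits)
  moreover have "(i, i) \<notin> parcs X" for i using asym by blast
  moreover have "(u, v) \<in> parcs (mk_symmetric (with_proj X)) \<longleftrightarrow> (u, v) \<in> parcs X \<or> (v, u) \<in> parcs X" for u v
    by (simp add: parcs_mk_symmetric) (metis fst_conv snd_conv prod.collapse)
  ultimately have "parcs (mk_symmetric (with_proj X)) = {(u, v). (u, v) \<in> UNIV \<times> UNIV \<and> u \<noteq> v}"
    by auto
  moreover have "CARD('v) = 2 \<or> CARD('v) = 3"
    using card_le_3_and_complete(1)[OF two entries] two by linarith
  ultimately show ?thesis
    by (simp add: complete_digraph_pair_def assms(2))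
qed

end
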